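(* For every integer $n\ge 8$, \[ \sum_{i=1}^{\lfloor n/2\rfloor}\binom{n-2i}{2}\ \le\ \operatorname{ex}_4(n,\mathrm{VD}_3^\circ)\ \le\ \frac{n}{4}\binom{n-2}{2}. \]
   Context: $\mathrm{VD}_3^\circ$ is the $4$-uniform hypergraph whose vertices are the $7$ non-empty subsets of $[3]=\{1,2,3\}$ and whose three edges are $E_i=\{A\subseteq[3]: i\in A\}$, $i=1,2,3$. $\operatorname{ex}_4(n,F)$ denotes the maximum number of edges in a $4$-uniform $n$-vertex hypergraph (a family of $4$-element subsets of an $n$-element set) containing no copy of $F$ as a subhypergraph (not necessarily induced). *)

theory Defs
  imports Complex_Main "HOL-Library.Ramsey"
begin

type_synonym 'a hypergraph = "'a set \<times> 'a set set"

abbreviation hverts :: "'a hypergraph \<Rightarrow> 'a set" where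
  "hverts H \<equiv> fst H"

abbreviation hedges :: "'a hypergraph \<Rightarrow> 'a set set" where
  "hedges H \<equiv> snd H"

definition uniform_hypergraph :: "nat \<Rightarrow> 'a hypergraph \<Rightarrow> bool" where
  "uniform_hypergraph k H \<longleftrightarrow> finite (hverts H) \<and> hedges H \<subseteq> nsets (hverts H) k"

text \<open>The copy need not be induced: \<open>H\<close> may have further edges on the image vertices.\<close>

definition contains_copy :: "'a hypergraph \<Rightarrow> 'b hypergraph \<Rightarrow> bool" where
  "contains_copy H F \<longleftrightarrow>
     (\<exists>f. inj_on f (hverts F) \<and> f ` hverts F \<subseteq> hverts H \<and> (\<forall>e \<in> hedges F. f ` e \<in> hedges H))"

definition free_sizes :: "nat \<Rightarrow> 'a set \<Rightarrow> 'b hypergraph \<Rightarrow> nat set" where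
  "free_sizes k V F =
     {card (hedges H) | H. hverts H = V \<and> uniform_hypergraph k H \<and> \<not> contains_copy H F}"

text \<open>
  The choice of the \<open>n\<close>-element vertex set is immaterial, see \<open>ex_num_eq\<close> below. As
  \<open>Max {}\<close> is unspecified, \<open>ex_num\<close> is meaningful if some \<open>F\<close>-free hypergraph exists,
  in particular if \<open>F\<close> has an edge.
\<close>

definition ex_num :: "nat \<Rightarrow> nat \<Rightarrow> 'b hypergraph \<Rightarrow> nat" where
  "ex_num k n F = Max (free_sizes k {1..n} F)"

definition VD3 :: "nat set hypergraph" where
  "VD3 = (Pow {1..3} - {{}}, (\<lambda>i. {A. A \<subseteq> {1..3} \<and> i \<in> A}) ` {1..3})"

lemma free_sizes_finite:
  assumes "finite V"
  shows "finite (free_sizes k V F)"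
proof -
  have "free_sizes k V F \<subseteq> card ` Pow (nsets V k)"
    unfolding free_sizes_def uniform_hypergraph_def by auto
  moreover have "finite (nsets V k)"
    using assms by (simp add: finite_imp_finite_nsets)
  ultimately show ?thesis
    by (meson finite_Pow_iff finite_imageI finite_subset)
qed

lemma free_sizes_nonempty:
  assumes "finite V" "hedges F \<noteq> {}"
  shows "0 \<in> free_sizes k V F"
proof -
  have "uniform_hypergraph k (V, {})" "\<not> contains_copy (V, {}) F"
    using assms by (auto simp: uniform_hypergraph_def contains_copy_def)
  then show ?thesis
    unfolding free_sizes_def by force
qed

lemma free_sizes_mono:
  assumes bij: "bij_betw g V W"
    and F: "\<And>e. e \<in> hedges F \<Longrightarrow> e \<subseteq> hverts F"
  shows "free_sizes k V F \<subseteq> free_sizes k W F"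
proof
  fix m assume "m \<in> free_sizes k V F"
  then obtain E where m: "m = card E" and u: "uniform_hypergraph k (V, E)"
    and nc: "\<not> contains_copy (V, E) F"
    by (auto simp: free_sizes_def)
  have inj: "inj_on g V" and im: "g ` V = W"
    using bij by (auto simp: bij_betw_def)
  have sub: "e \<subseteq> V" "finite e" "card e = k" if "e \<in> E" for e
    using u that by (auto simp: uniform_hypergraph_def nsets_def)
  let ?E = "(`) g ` E"
  let ?h = "the_inv_into V g"
  have hg: "?h ` (g ` e) = e" if "e \<in> E" for e
    using sub(1)[OF that] inj by (force simp: image_image the_inv_into_f_f)
  have "inj_on ((`) g) E"
    by (metis hg inj_onI)
  then have "card ?E = m"
    by (simp add: m card_image)
  moreover have "uniform_hypergraph k (W, ?E)"
  proof -
    have "card (g ` e) = k" if "e \<in> E" for e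
      using sub[OF that] inj by (metis card_image inj_on_subset)
    then show ?thesis
      using u sub im by (auto simp: uniform_hypergraph_def nsets_def)
  qed
  moreover have "\<not> contains_copy (W, ?E) F"
  proof
    assume "contains_copy (W, ?E) F"
    then obtain f where f: "inj_on f (hverts F)" "f ` hverts F \<subseteq> W"
      "\<And>e. e \<in> hedges F \<Longrightarrow> f ` e \<in> ?E"
      by (auto simp: contains_copy_def)
    have "inj_on ?h W"
      using inj im inj_on_the_inv_into by blast
    then have "inj_on (?h \<circ> f) (hverts F)"
      using f by (meson comp_inj_on inj_on_subset)
    moreover have "(?h \<circ> f) ` hverts F \<subseteq> V"
      using f(2) inj im by (force simp: the_inv_into_into)
    moreover have "(?h \<circ> f) ` e \<in> E" if e: "e \<in> hedges F" for e
    proof -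
      obtain d where "d \<in> E" "f ` e = g ` d"
        using f(3)[OF e] by auto
      then show ?thesis
        using hg by (metis image_comp)
    qed
    ultimately show False
      using nc unfolding contains_copy_def fst_conv snd_conv by blast
  qed
  ultimately show "m \<in> free_sizes k W F"
    unfolding free_sizes_def by force
qed

lemma ex_num_eq:
  assumes "finite V" "card V = n" "\<And>e. e \<in> hedges F \<Longrightarrow> e \<subseteq> hverts F"
  shows "ex_num k n F = Max (free_sizes k V F)"
proof -
  obtain g where g: "bij_betw g V {1..n}"
    using assms by (metis card_atLeastAtMost diff_Suc_1 finite_atLeastAtMost finite_same_card_bij)
  have "free_sizes k V F = free_sizes k {1..n} F"
    using free_sizes_mono[OF g assms(3)] free_sizes_mono[OF bij_betw_inv_into[OF g] assms(3)]
    by blast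
  then show ?thesis
    by (simp add: ex_num_def)
qed

lemma VD3_edges:
  "hedges VD3 = {{{1}, {1,2}, {1,3}, {1,2,3}}, {{2}, {1,2}, {2,3}, {1,2,3}}, {{3}, {1,3}, {2,3}, {1,2,3}}}"
proof -
  have I: "{1..3::nat} = {1,2,3}"
    by auto
  have "{A. A \<subseteq> {1,2,3::nat} \<and> 1 \<in> A} = {{1}, {1,2}, {1,3}, {1,2,3}}"
    "{A. A \<subseteq> {1,2,3::nat} \<and> 2 \<in> A} = {{2}, {1,2}, {2,3}, {1,2,3}}"
    "{A. A \<subseteq> {1,2,3::nat} \<and> 3 \<in> A} = {{3}, {1,3}, {2,3}, {1,2,3}}"
    unfolding Pow_iff[symmetric] Pow_insert by (auto simp: Pow_insert)
  then show ?thesis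
    unfolding VD3_def I snd_conv image_insert image_empty by (simp only:)
qed

lemma VD3_uniform: "uniform_hypergraph 4 VD3"
proof -
  have "e \<subseteq> hverts VD3" if "e \<in> hedges VD3" for e
    using that by (auto simp: VD3_def)
  moreover have "finite e \<and> card e = 4" if "e \<in> hedges VD3" for e
    using that unfolding VD3_edges by (auto simp: card_insert_if insert_eq_iff doubleton_eq_iff)
  ultimately show ?thesis
    by (auto simp: uniform_hypergraph_def nsets_def VD3_def)
qed

lemma VD3_card_verts: "card (hverts VD3) = 7"
  by (simp add: VD3_def card_Pow card_Diff_subset)

end

theory Submission
  imports Defs
begin

text \<open>
  For the upper bound, fix a vertex \<open>v\<close> of a 4-uniform hypergraph and pass to its link, a system of
  triples on the other vertices. Three triples \<open>{a,b,x}\<close>, \<open>{b,c,y}\<close>, \<open>{a,c,z}\<close> on six points (a loose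
  triangle) in the link become a copy of the forbidden hypergraph when \<open>v\<close> is added to each of them.
  So all links are free of loose triangles, and it is enough to show that a triple system \<open>H\<close> without
  loose triangles on \<open>m \<ge> 7\<close> points has at most \<open>(m - 1) choose 2\<close> triples
  (\<open>loose_triangle_free_card_le\<close>): the sizes of the links add up to four times the number of edges.

  The proof of this bound starts from the boundary map over the two-element field, which sends a
  family of triples to the pairs that it covers an odd number of times. If no nonempty subfamily of
  \<open>H\<close> covers every pair an even number of times, the boundary map is injective on subfamilies of \<open>H\<close>,
  even when only the pairs avoiding a fixed point are recorded, and the bound follows
  (\<open>card_le_choose_if_no_even_family\<close>). If there is such an even subfamily, the absence of loose
  triangles makes it so rigid that it contains the four triples on four points (a tetrahedron) or
  the six triples joining two apexes to the sides of a triangle (a bipyramid); see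
  \<open>even_family_contains_tetrahedron_or_bipyramid\<close>.

  It remains to see that such a cluster makes \<open>H\<close> small. Let \<open>X\<close> be its vertex set. Edges of \<open>H\<close> that
  cross between \<open>X\<close> and the outside are severely restricted. After deleting the edges inside \<open>X\<close> and
  a few crossing edges, the shadow of the rest \<open>H'\<close> contains few of the pairs between \<open>X\<close> and the
  outside. Since a triple system without loose triangles never has more triples than pairs in its
  shadow (\<open>card_le_card_shadow\<close>, proved by deleting clusters one after the other), this bounds \<open>H'\<close>.
  Distributing the deleted edges and the pairs that cross over the outside points
  (\<open>card_le_local_charges\<close>), each outside point pays at most 2 next to a tetrahedron and at most
  5/2 next to a bipyramid, apart from one point that can pay more but is compensated elsewhere. The
  bound to be proved allows 3 and 4, respectively, and from seven points on the surplus outweighs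
  the constant terms; only a bipyramid on exactly seven points is treated by a direct count.

  For the lower bound, group the points into pairs \<open>{2 * i - 1, 2 * i}\<close> and take as edges all the sets
  that consist of such a pair and two larger points. In a copy of the forbidden hypergraph the edge
  with the least pair would meet the other two in three of its points, which forces all three edges
  to contain that pair, although only one point lies in all three of them.
\<close>

section \<open>Loose triangles and shadows\<close>

text \<open>
  Being a finite system of triples is part of the definition, so that it passes to subfamilies
  together with the absence of a loose triangle.
\<close>

definition loose_triangle_free :: "'a set set \<Rightarrow> bool" where
  "loose_triangle_free H \<longleftrightarrow> finite H \<and> (\<forall>e\<in>H. card e = 3) \<and>
    \<not> (\<exists>a b c x y z. distinct [a,b,c,x,y,z] \<and> {a,b,x} \<in> H \<and> {b,c,y} \<in> H \<and> {a,c,z} \<in> H)"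

definition shadow :: "'a set set \<Rightarrow> 'a set set" where
  "shadow H = {P. card P = 2 \<and> (\<exists>e\<in>H. P \<subseteq> e)}"

text \<open>
  For a finite family of triples, this says that it is a cycle for the simplicial boundary map from
  triples to pairs with coefficients in the two-element field.
\<close>

definition even_family :: "'a set set \<Rightarrow> bool" where
  "even_family C \<longleftrightarrow> (\<forall>P. card P = 2 \<longrightarrow> even (card {e\<in>C. P \<subseteq> e}))"

lemma loose_triangle_freeD:
  assumes "loose_triangle_free H" "{a,b,x} \<in> H" "{b,c,y} \<in> H" "{a,c,z} \<in> H"
    "distinct [a,b,c,x,y,z]"
  shows False
  using assms unfolding loose_triangle_free_def by blast

lemma loose_triangle_free_subset:
  assumes "loose_triangle_free H" "H' \<subseteq> H"
  shows "loose_triangle_free H'"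
  using assms unfolding loose_triangle_free_def by (meson finite_subset subsetD)

lemma loose_triangle_free_distinct:
  assumes "loose_triangle_free H" "{a,b,c} \<in> H"
  shows "a \<noteq> b" "a \<noteq> c" "b \<noteq> c"
proof -
  have "card {a,b,c} = 3"
    using assms unfolding loose_triangle_free_def by blast
  then show "a \<noteq> b" "a \<noteq> c" "b \<noteq> c"
    by (auto simp: card_insert_if split: if_splits)
qed

lemma triple_third_vertex:
  assumes "card e = 3" "p \<in> e" "q \<in> e" "p \<noteq> q"
  obtains r where "e = {p,q,r}" "r \<noteq> p" "r \<noteq> q"
proof -
  have "finite e"
    using assms(1) by (simp add: card_ge_0_finite)
  then have "card (e - {p,q}) = 1"
    using assms by (simp add: card_Diff_subset)
  then obtain r where "e - {p,q} = {r}"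
    by (auto simp: card_1_singleton_iff)
  then show thesis
    using that[of r] assms by blast
qed

lemma mem_shadow_iff:
  assumes "loose_triangle_free H"
  shows "{p,q} \<in> shadow H \<longleftrightarrow> (\<exists>r. {p,q,r} \<in> H)"
proof
  assume "{p,q} \<in> shadow H"
  then obtain e where e: "e \<in> H" "p \<in> e" "q \<in> e" "p \<noteq> q"
    unfolding shadow_def by (force simp: card_2_iff)
  moreover from e have "card e = 3"
    using assms unfolding loose_triangle_free_def by blast
  ultimately show "\<exists>r. {p,q,r} \<in> H"
    by (metis triple_third_vertex)
next
  assume "\<exists>r. {p,q,r} \<in> H"
  then obtain r where "{p,q,r} \<in> H" ..
  moreover from this have "card {p,q} = 2"
    using loose_triangle_free_distinct(1)[OF assms] by simp
  moreover have "{p,q} \<subseteq> {p,q,r}" by blast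
  ultimately show "{p,q} \<in> shadow H"
    unfolding shadow_def by blast
qed

lemma pairs_of_triple_in_shadow:
  assumes "loose_triangle_free H" "{p,q,r} \<in> H"
  shows "{p,q} \<in> shadow H" "{p,r} \<in> shadow H" "{q,r} \<in> shadow H"
  using assms(2) unfolding mem_shadow_iff[OF assms(1)]
  by (metis insert_commute)+

lemma finite_shadow:
  assumes "loose_triangle_free H"
  shows "finite (shadow H)"
proof -
  have "finite e" if "e \<in> H" for e
    using assms that unfolding loose_triangle_free_def by (metis card.infinite zero_neq_numeral)
  then have "finite (\<Union>e\<in>H. Pow e)"
    using assms unfolding loose_triangle_free_def by blast
  then show ?thesis
    by (rule rev_finite_subset) (auto simp: shadow_def)
qed

section \<open>Independence modulo two\<close>

text \<open>
  Linear independence over the two-element field, without vector spaces: sending a subfamily to the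
  set of pairs of \<open>Q\<close> that it covers an odd number of times turns symmetric differences into
  symmetric differences, so a trivial kernel makes this map injective on the subsets of \<open>H\<close>.
\<close>

lemma card_le_of_parity_determined:
  assumes "finite H" "finite Q"
    and det: "\<And>C. C \<subseteq> H \<Longrightarrow> (\<And>P. P \<in> Q \<Longrightarrow> even (card {e\<in>C. P \<subseteq> e})) \<Longrightarrow> C = {}"
  shows "card H \<le> card Q"
proof -
  define f where "f C = {P\<in>Q. odd (card {e\<in>C. P \<subseteq> e})}" for C
  have "inj_on f (Pow H)"
  proof (rule inj_onI)
    fix A B assume A: "A \<in> Pow H" and B: "B \<in> Pow H" and eq: "f A = f B"
    have fin: "finite A" "finite B"
      using A B assms(1) finite_subset by auto
    let ?D = "(A - B) \<union> (B - A)"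
    have "?D = {}"
    proof (rule det)
      show "?D \<subseteq> H" using A B by blast
      fix P assume P: "P \<in> Q"
      let ?I = "{e\<in>A \<inter> B. P \<subseteq> e}" and ?a = "{e\<in>A - B. P \<subseteq> e}" and ?b = "{e\<in>B - A. P \<subseteq> e}"
      have "{e\<in>A. P \<subseteq> e} = ?I \<union> ?a" "{e\<in>B. P \<subseteq> e} = ?I \<union> ?b" "{e\<in>?D. P \<subseteq> e} = ?a \<union> ?b"
        by blast+
      moreover have "card (?I \<union> ?a) = card ?I + card ?a" "card (?I \<union> ?b) = card ?I + card ?b"
        "card (?a \<union> ?b) = card ?a + card ?b"
        using fin by (intro card_Un_disjoint; auto)+
      moreover have "even (card {e\<in>A. P \<subseteq> e}) \<longleftrightarrow> even (card {e\<in>B. P \<subseteq> e})"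
        using eq P unfolding f_def by blast
      ultimately show "even (card {e\<in>?D. P \<subseteq> e})"
        by auto
    qed
    then show "A = B" by blast
  qed
  moreover have "f ` Pow H \<subseteq> Pow Q"
    unfolding f_def by blast
  ultimately have "card (Pow H) \<le> card (Pow Q)"
    using assms(2) by (meson card_inj_on_le finite_Pow_iff)
  then show ?thesis
    using assms by (simp add: card_Pow)
qed

text \<open>
  A pair \<open>{v,w}\<close> at the omitted point \<open>w\<close> is controlled by the others: the triples of \<open>C\<close> through
  \<open>v\<close>, counted once for each further point, are counted twice each, so the degrees of all the pairs
  at \<open>v\<close> add up to an even number. This is the reason why the bound below has
  \<open>(card V - 1) choose 2\<close> in place of \<open>card V choose 2\<close>.
\<close>

lemma even_family_if_even_off_vertex:
  assumes "finite C" "\<And>e. e \<in> C \<Longrightarrow> card e = 3"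
    and ev: "\<And>P. card P = 2 \<Longrightarrow> w \<notin> P \<Longrightarrow> even (card {e\<in>C. P \<subseteq> e})"
  shows "even_family C"
  unfolding even_family_def
proof (intro allI impI)
  fix P :: "'a set" assume P: "card P = 2"
  show "even (card {e\<in>C. P \<subseteq> e})"
  proof (cases "w \<in> P")
    case False
    then show ?thesis using ev P by blast
  next
    case True
    then obtain v where v: "P = {v,w}" "v \<noteq> w"
      using P by (metis card_2_iff doubleton_eq_iff insertE singletonD)
    have fine: "finite e" if "e \<in> C" for e
      using assms(2)[OF that] by (metis card.infinite zero_neq_numeral)
    define Y where "Y = \<Union>C - {v}"
    have finY: "finite Y"
      using assms(1) fine by (auto simp: Y_def)
    have "(\<Sum>y\<in>Y. card {e\<in>C. {v,y} \<subseteq> e}) = (\<Sum>y\<in>Y. \<Sum>e\<in>C. if {v,y} \<subseteq> e then 1 else 0)"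
      using assms(1) by (intro sum.cong refl) (simp add: sum.If_cases Int_def)
    also have "\<dots> = (\<Sum>e\<in>C. \<Sum>y\<in>Y. if {v,y} \<subseteq> e then 1 else 0)"
      by (rule sum.swap)
    also have "\<dots> = (\<Sum>e\<in>C. if v \<in> e then 2 else 0)"
    proof (intro sum.cong refl)
      fix e assume e: "e \<in> C"
      have "{y\<in>Y. y \<in> e} = e - {v}"
        using e by (auto simp: Y_def)
      then show "(\<Sum>y\<in>Y. if {v,y} \<subseteq> e then 1 else 0) = (if v \<in> e then 2 else (0::nat))"
        using finY assms(2)[OF e] fine[OF e] by (simp add: sum.If_cases Int_def)
    qed
    finally have tot: "even (\<Sum>y\<in>Y. card {e\<in>C. {v,y} \<subseteq> e})"
      by (simp add: dvd_sum)
    show ?thesis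
    proof (cases "w \<in> Y")
      case False
      then have none: "{e\<in>C. P \<subseteq> e} = {}"
        using v by (auto simp: Y_def)
      show ?thesis unfolding none by simp
    next
      case True
      have "even (\<Sum>y\<in>Y-{w}. card {e\<in>C. {v,y} \<subseteq> e})"
        using v by (intro dvd_sum ev) (auto simp: Y_def)
      then show ?thesis
        using tot True finY v by (simp add: sum.remove[of Y w])
    qed
  qed
qed

lemma card_le_choose_if_no_even_family:
  assumes "finite V" "V \<noteq> {}" "H \<subseteq> nsets V 3" "\<And>C. C \<subseteq> H \<Longrightarrow> even_family C \<Longrightarrow> C = {}"
  shows "card H \<le> (card V - 1) choose 2"
proof -
  obtain w where w: "w \<in> V" using assms(2) by blast
  have finH: "finite H"
    using assms by (meson finite_imp_finite_nsets finite_subset)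
  have "card H \<le> card (nsets (V - {w}) 2)"
  proof (rule card_le_of_parity_determined)
    show "finite H" by (fact finH)
    show "finite (nsets (V - {w}) 2)"
      using assms by (simp add: finite_imp_finite_nsets)
    fix C assume C: "C \<subseteq> H" and ev: "\<And>P. P \<in> nsets (V - {w}) 2 \<Longrightarrow> even (card {e\<in>C. P \<subseteq> e})"
    have "even_family C"
    proof (rule even_family_if_even_off_vertex)
      show "finite C" using C finH finite_subset by blast
      show "card e = 3" if "e \<in> C" for e
        using that C assms(3) by (auto simp: nsets_def)
      fix P :: "'a set" assume P: "card P = 2" "w \<notin> P"
      show "even (card {e\<in>C. P \<subseteq> e})"
      proof (cases "P \<subseteq> V")
        case True
        then show ?thesis
          using P assms(1) by (intro ev) (auto simp: nsets_def finite_subset)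
      next
        case False
        then have none: "{e\<in>C. P \<subseteq> e} = {}"
          using C assms(3) by (auto simp: nsets_def)
        show ?thesis unfolding none by simp
      qed
    qed
    then show "C = {}" using assms(4) C by blast
  qed
  then show ?thesis
    using w assms(1) by (simp add: card_nsets)
qed

lemma card_le_shadow_if_no_even_family:
  assumes "loose_triangle_free H" "\<And>C. C \<subseteq> H \<Longrightarrow> even_family C \<Longrightarrow> C = {}"
  shows "card H \<le> card (shadow H)"
proof (rule card_le_of_parity_determined)
  show "finite H" using assms by (simp add: loose_triangle_free_def)
  show "finite (shadow H)" by (rule finite_shadow[OF assms(1)])
  fix C assume C: "C \<subseteq> H" and ev: "\<And>P. P \<in> shadow H \<Longrightarrow> even (card {e\<in>C. P \<subseteq> e})"
  have "even (card {e\<in>C. P \<subseteq> e})" if P: "card P = 2" for P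
  proof (cases "P \<in> shadow H")
    case True then show ?thesis by (rule ev)
  next
    case False
    then have none: "{e\<in>C. P \<subseteq> e} = {}"
      using C P by (auto simp: shadow_def)
    show ?thesis unfolding none by simp
  qed
  then show "C = {}"
    using assms(2) C unfolding even_family_def by blast
qed

section \<open>Even families contain a tetrahedron or a bipyramid\<close>

definition tetrahedron :: "'a set set \<Rightarrow> 'a \<Rightarrow> 'a \<Rightarrow> 'a \<Rightarrow> 'a \<Rightarrow> bool" where
  "tetrahedron H a b c d \<longleftrightarrow> distinct [a,b,c,d] \<and>
    {a,b,c} \<in> H \<and> {a,b,d} \<in> H \<and> {a,c,d} \<in> H \<and> {b,c,d} \<in> H"

definition bipyramid :: "'a set set \<Rightarrow> 'a \<Rightarrow> 'a \<Rightarrow> 'a \<Rightarrow> 'a \<Rightarrow> 'a \<Rightarrow> bool" where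
  "bipyramid H p q a b c \<longleftrightarrow> distinct [p,q,a,b,c] \<and>
    {p,a,b} \<in> H \<and> {p,a,c} \<in> H \<and> {p,b,c} \<in> H \<and>
    {q,a,b} \<in> H \<and> {q,a,c} \<in> H \<and> {q,b,c} \<in> H"

definition conbrs :: "'a set set \<Rightarrow> 'a \<Rightarrow> 'a \<Rightarrow> 'a set" where
  "conbrs H p q = {r. {p,q,r} \<in> H}"

lemma conbrs_commute: "conbrs H p q = conbrs H q p"
  by (simp add: conbrs_def insert_commute)

lemma card_conbrs:
  assumes "loose_triangle_free H" "p \<noteq> q"
  shows "card (conbrs H p q) = card {e\<in>H. {p,q} \<subseteq> e}"
proof (rule bij_betw_same_card)
  show "bij_betw (\<lambda>r. {p,q,r}) (conbrs H p q) {e\<in>H. {p,q} \<subseteq> e}"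
    unfolding bij_betw_def
  proof
    show "inj_on (\<lambda>r. {p,q,r}) (conbrs H p q)"
      using loose_triangle_free_distinct[OF assms(1)]
      by (auto simp: inj_on_def conbrs_def) (metis insertE insertI1 insert_commute singletonD)
    show "(\<lambda>r. {p,q,r}) ` conbrs H p q = {e\<in>H. {p,q} \<subseteq> e}"
    proof
      show "{e\<in>H. {p,q} \<subseteq> e} \<subseteq> (\<lambda>r. {p,q,r}) ` conbrs H p q"
      proof
        fix e assume e: "e \<in> {e\<in>H. {p,q} \<subseteq> e}"
        then have "card e = 3" using assms(1) by (simp add: loose_triangle_free_def)
        then obtain r where "e = {p,q,r}"
          using e assms(2) triple_third_vertex[of e p q] by auto
        then show "e \<in> (\<lambda>r. {p,q,r}) ` conbrs H p q"
          using e by (simp add: conbrs_def)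
      qed
    qed (auto simp: conbrs_def)
  qed
qed

lemma odd_card_cases:
  assumes "odd (card A)"
  obtains x where "A = {x}" | x y z where "{x,y,z} \<subseteq> A" "x \<noteq> y" "y \<noteq> z" "x \<noteq> z"
proof (cases "card A = 1")
  case True
  then show thesis using that(1) card_1_singletonE by metis
next
  case False
  then have "3 \<le> card A" using assms by presburger
  then obtain B where "B \<subseteq> A" "card B = 3" by (meson obtain_subset_with_card_n)
  then show thesis using that(2) by (metis card_3_iff)
qed

text \<open>
  The parity makes Hall's condition rigid: an odd set is a singleton or has at least three elements,
  and a set with three elements always leaves a representative different from two given points.
\<close>

lemma odd_sets_without_distinct_representatives:
  assumes "odd (card A)" "odd (card B)" "odd (card C)"
    and no: "\<And>x y z. x \<in> A \<Longrightarrow> y \<in> B \<Longrightarrow> z \<in> C \<Longrightarrow> x \<noteq> y \<Longrightarrow> y \<noteq> z \<Longrightarrow> x \<noteq> z \<Longrightarrow> False"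
  shows "\<exists>x. A = {x} \<and> B = {x} \<or> A = {x} \<and> C = {x} \<or> B = {x} \<and> C = {x}"
proof -
  have third: "\<exists>x\<in>S. x \<noteq> u \<and> x \<noteq> v" if "{x,y,z} \<subseteq> S" "x \<noteq> y" "y \<noteq> z" "x \<noteq> z" for S x y z and u v :: 'a
  proof (rule ccontr)
    assume "\<not> ?thesis"
    then have "x = u \<or> x = v" "y = u \<or> y = v" "z = u \<or> z = v" using that(1) by blast+
    then show False using that(2-4) by blast
  qed
  have ne: "A \<noteq> {}" "B \<noteq> {}" "C \<noteq> {}" using assms(1-3) by auto
  have two: "(\<exists>u\<in>S. \<exists>v\<in>T. u \<noteq> v) \<or> (\<exists>x. S = {x} \<and> T = {x})" if "S \<noteq> {}" and "T \<noteq> {}" for S T :: "'a set"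
  proof (cases "\<exists>u\<in>S. \<exists>v\<in>T. u \<noteq> v")
    case False
    obtain s t where s: "s \<in> S" and t: "t \<in> T" using \<open>S \<noteq> {}\<close> \<open>T \<noteq> {}\<close> by blast
    have eq: "u = v" if "u \<in> S" "v \<in> T" for u v using False that by blast
    have "S \<subseteq> {t}" using eq t by blast
    moreover have "T \<subseteq> {t}" using eq[OF s] t by blast
    moreover have "t \<in> S" using eq[OF s t] s by simp
    ultimately have "S = {t}" "T = {t}" using t by blast+
    then show ?thesis by (intro disjI2 exI conjI)
  qed (rule disjI1)
  show ?thesis
    using assms(1)
  proof (cases rule: odd_card_cases)
    case A: (1 a)
    show ?thesis using assms(2)
    proof (cases rule: odd_card_cases)
      case B: (1 b)
      show ?thesis using assms(3)
      proof (cases rule: odd_card_cases)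
        case C: (1 c)
        have "a = b \<or> b = c \<or> a = c"
          using no[of a b c] unfolding A B C by blast
        then show ?thesis using A B C by auto
      next
        case (2 x y z)
        then obtain t where "t \<in> C" "t \<noteq> a" "t \<noteq> b"
          using third[OF 2, of a b] by blast
        then have "a = b" using no[of a b t] unfolding A B by blast
        then show ?thesis using A B by auto
      qed
    next
      case (2 x y z)
      from two[OF ne(1,3)] show ?thesis
      proof
        assume "\<exists>u\<in>A. \<exists>v\<in>C. u \<noteq> v"
        then obtain u v where uv: "u \<in> A" "v \<in> C" "u \<noteq> v" by blast
        obtain t where "t \<in> B" "t \<noteq> u" "t \<noteq> v"
          using third[OF 2, of u v] by blast
        then show ?thesis using no[of u t v] uv by blast
      qed blast
    qed
  next
    case (2 x y z)
    from two[OF ne(2,3)] show ?thesis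
    proof
      assume "\<exists>u\<in>B. \<exists>v\<in>C. u \<noteq> v"
      then obtain u v where uv: "u \<in> B" "v \<in> C" "u \<noteq> v" by blast
      obtain t where "t \<in> A" "t \<noteq> u" "t \<noteq> v"
        using third[OF 2, of u v] by blast
      then show ?thesis using no[of t u v] uv by blast
    qed blast
  qed
qed

lemma even_family_conbrs:
  assumes "loose_triangle_free C" "even_family C" "p \<noteq> q"
  shows "even (card (conbrs C p q))"
  using assms(2,3) unfolding card_conbrs[OF assms(1,3)] even_family_def by (metis card_2_iff)

lemma finite_conbrs:
  assumes "loose_triangle_free H" "p \<noteq> q"
  shows "finite (conbrs H p q)"
proof -
  have "finite (\<Union>H)"
    using assms(1) unfolding loose_triangle_free_def by (metis card.infinite finite_Union zero_neq_numeral)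
  then show ?thesis
    by (rule rev_finite_subset) (auto simp: conbrs_def)
qed

lemma odd_card_conbrs_minus:
  assumes "loose_triangle_free C" "even_family C" "{p,q,r} \<in> C"
  shows "odd (card (conbrs C p q - {r}))"
proof -
  have "p \<noteq> q" "r \<in> conbrs C p q"
    using loose_triangle_free_distinct(1)[OF assms(1,3)] assms(3) by (auto simp: conbrs_def)
  then have "card (conbrs C p q) = Suc (card (conbrs C p q - {r}))"
    using finite_conbrs[OF assms(1)] by (metis card_Suc_Diff1)
  then show ?thesis
    using even_family_conbrs[OF assms(1,2) \<open>p \<noteq> q\<close>] by simp
qed

text \<open>
  Distinct points \<open>x\<close>, \<open>y\<close>, \<open>z\<close> outside an edge \<open>{a,b,c}\<close> that extend its three sides would form a
  loose triangle with core \<open>a\<close>, \<open>b\<close>, \<open>c\<close>, and each side has an odd number of extensions other than the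
  third vertex of the edge itself.
\<close>

lemma even_family_local_structure:
  assumes ltf: "loose_triangle_free C" and "even_family C" "{a,b,c} \<in> C"
  shows "\<exists>x. conbrs C a b - {c} = {x} \<and> conbrs C b c - {a} = {x}
           \<or> conbrs C a b - {c} = {x} \<and> conbrs C a c - {b} = {x}
           \<or> conbrs C b c - {a} = {x} \<and> conbrs C a c - {b} = {x}"
proof (rule odd_sets_without_distinct_representatives)
  have edges: "{a,b,c} \<in> C" "{b,c,a} \<in> C" "{a,c,b} \<in> C"
    using assms(3) by (simp_all add: insert_commute)
  show "odd (card (conbrs C a b - {c}))" "odd (card (conbrs C b c - {a}))"
    "odd (card (conbrs C a c - {b}))"
    by (rule odd_card_conbrs_minus[OF assms(1,2) edges(1)]
             odd_card_conbrs_minus[OF assms(1,2) edges(2)]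
             odd_card_conbrs_minus[OF assms(1,2) edges(3)])+
  fix x y z assume "x \<in> conbrs C a b - {c}" "y \<in> conbrs C b c - {a}" "z \<in> conbrs C a c - {b}"
    and ne: "x \<noteq> y" "y \<noteq> z" "x \<noteq> z"
  then have e: "{a,b,x} \<in> C" "{b,c,y} \<in> C" "{a,c,z} \<in> C" and ne': "x \<noteq> c" "y \<noteq> a" "z \<noteq> b"
    by (auto simp: conbrs_def)
  note d = loose_triangle_free_distinct[OF ltf]
  show False
    using loose_triangle_freeD[OF ltf e] d[OF e(1)] d[OF e(2)] d[OF e(3)] ne ne' by auto
qed

text \<open>
  The point \<open>a\<close> is joined to the three sides of the triangle \<open>b\<close>, \<open>c\<close>, \<open>x\<close>. If \<open>{b,c,x}\<close> is an edge,
  this is a tetrahedron. Otherwise evenness forces each side of this triangle into another edge,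
  and two different third points would create a loose triangle; the common third point is the
  second apex of a bipyramid.
\<close>

lemma tetrahedron_or_bipyramid_at_apex:
  assumes ltf: "loose_triangle_free C" and ev: "even_family C" and abc: "{a,b,c} \<in> C"
    and nab: "conbrs C a b - {c} = {x}" and nac: "conbrs C a c - {b} = {x}"
  shows "(\<exists>a b c d. tetrahedron C a b c d) \<or> (\<exists>p q a b c. bipyramid C p q a b c)"
proof -
  note d = loose_triangle_free_distinct[OF ltf]
  have abx: "{a,b,x} \<in> C" and acx: "{a,c,x} \<in> C" and xne: "x \<noteq> b" "x \<noteq> c"
    using nab nac by (auto simp: conbrs_def)
  have dist: "distinct [a,b,c,x]"
    using d[OF abc] d[OF abx] xne by auto
  show ?thesis
  proof (cases "{b,c,x} \<in> C")
    case True
    then show ?thesis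
      using abc abx acx dist unfolding tetrahedron_def by blast
  next
    case False
    \<comment> \<open>Each side of the triangle b, c, x lies in an edge with apex a, hence in a second one.\<close>
    have odd_bc: "odd (card (conbrs C b c - {a}))" and odd_cx: "odd (card (conbrs C c x - {a}))"
      and odd_bx: "odd (card (conbrs C b x - {a}))"
      using odd_card_conbrs_minus[OF ltf ev, of b c a] odd_card_conbrs_minus[OF ltf ev, of c x a]
        odd_card_conbrs_minus[OF ltf ev, of b x a] abc abx acx by (simp_all add: insert_commute)
    then obtain y w z where "y \<in> conbrs C b c - {a}" "w \<in> conbrs C c x - {a}" "z \<in> conbrs C b x - {a}"
      by (metis all_not_in_conv card.empty even_zero)
    then have bcy: "{b,c,y} \<in> C" and cxw: "{c,x,w} \<in> C" and bxz: "{b,x,z} \<in> C"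
      and ne: "y \<noteq> a" "w \<noteq> a" "z \<noteq> a"
      by (auto simp: conbrs_def)
    have ne': "y \<noteq> x" "w \<noteq> b" "z \<noteq> c"
      using False bcy cxw bxz by (auto simp: insert_commute)
    have "y = w"
    proof (rule ccontr)
      assume "y \<noteq> w"
      then show False
        using loose_triangle_freeD[OF ltf, of x b a c y w] abx bcy cxw dist ne ne'
          d[OF bcy] d[OF cxw] by (auto simp: insert_commute)
    qed
    moreover have "y = z"
    proof (rule ccontr)
      assume "y \<noteq> z"
      then show False
        using loose_triangle_freeD[OF ltf, of x c a b y z] acx bcy bxz dist ne ne'
          d[OF bcy] d[OF bxz] by (auto simp: insert_commute)
    qed
    ultimately have "bipyramid C a y b c x"
      using abc abx acx bcy cxw bxz dist ne ne' d[OF bcy] unfolding bipyramid_def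
      by (auto simp: insert_commute)
    then show ?thesis by blast
  qed
qed

lemma even_family_contains_tetrahedron_or_bipyramid:
  assumes ltf: "loose_triangle_free C" and ev: "even_family C" and "C \<noteq> {}"
  shows "(\<exists>a b c d. tetrahedron C a b c d) \<or> (\<exists>p q a b c. bipyramid C p q a b c)"
proof -
  obtain e where "e \<in> C" using assms(3) by blast
  moreover from this have "card e = 3" using ltf by (simp add: loose_triangle_free_def)
  ultimately obtain a b c where abc: "{a,b,c} \<in> C"
    by (metis card_3_iff)
  have perms: "{b,a,c} \<in> C" "{c,a,b} \<in> C"
    using abc by (simp_all add: insert_commute)
  note apex = tetrahedron_or_bipyramid_at_apex[OF ltf ev]
  show ?thesis
    using even_family_local_structure[OF ltf ev abc] apex[OF abc] apex[OF perms(1)] apex[OF perms(2)]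
    by (metis conbrs_commute)
qed

section \<open>Edges meeting a bipyramid or a tetrahedron\<close>

lemma bipyramid_commute:
  "bipyramid H p q a b c \<Longrightarrow> bipyramid H q p a b c"
  "bipyramid H p q a b c \<Longrightarrow> bipyramid H p q b a c"
  "bipyramid H p q a b c \<Longrightarrow> bipyramid H p q a c b"
  by (auto simp: bipyramid_def insert_commute)

lemma tetrahedron_commute:
  "tetrahedron H a b c d \<Longrightarrow> tetrahedron H b a c d"
  "tetrahedron H a b c d \<Longrightarrow> tetrahedron H a c b d"
  "tetrahedron H a b c d \<Longrightarrow> tetrahedron H a b d c"
  by (auto simp: tetrahedron_def insert_commute)

text \<open>
  Up to the symmetries of the bipyramid the pair consists of the two apexes, of an apex and a base
  vertex, or of two base vertices. In each case the edge closes a loose triangle with two edges of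
  the bipyramid.
\<close>

lemma bipyramid_no_edge_meets_in_two:
  assumes ltf: "loose_triangle_free H" and bip: "bipyramid H p q a b c"
    and s: "s \<in> {p,q,a,b,c}" and t: "t \<in> {p,q,a,b,c}" and "s \<noteq> t" and u: "u \<notin> {p,q,a,b,c}"
  shows "{s,t,u} \<notin> H"
proof -
  have apexes: "{p,q,u} \<notin> H" if "bipyramid H p q a b c" "u \<notin> {p,q,a,b,c}" for p q a b c
    using loose_triangle_freeD[OF ltf, of p q u a c b] that
    by (auto simp: bipyramid_def insert_commute)
  have side: "{p,a,u} \<notin> H" if "bipyramid H p q a b c" "u \<notin> {p,q,a,b,c}" for p q a b c
    using loose_triangle_freeD[OF ltf, of p a u b q c] that
    by (auto simp: bipyramid_def insert_commute)
  have base: "{a,b,u} \<notin> H" if "bipyramid H p q a b c" "u \<notin> {p,q,a,b,c}" for p q a b c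
    using loose_triangle_freeD[OF ltf, of a b u c q p] that
    by (auto simp: bipyramid_def insert_commute)
  note bip' = bip bipyramid_commute(2)[OF bip] bipyramid_commute(3)[OF bip]
    bipyramid_commute(2)[OF bipyramid_commute(3)[OF bip]]
  have "{p,q,u} \<notin> H" "{p,a,u} \<notin> H" "{p,b,u} \<notin> H" "{p,c,u} \<notin> H"
    "{q,a,u} \<notin> H" "{q,b,u} \<notin> H" "{q,c,u} \<notin> H" "{a,b,u} \<notin> H" "{a,c,u} \<notin> H" "{b,c,u} \<notin> H"
    using u apexes[OF bip'(1)] side[OF bip'(1)] side[OF bip'(2)] side[OF bip'(4)]
      side[OF bipyramid_commute(1)[OF bip'(1)]] side[OF bipyramid_commute(1)[OF bip'(2)]]
      side[OF bipyramid_commute(1)[OF bip'(4)]]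
      base[OF bip'(1)] base[OF bip'(3)] base[OF bipyramid_commute(3)[OF bip'(2)]]
    by auto
  then show ?thesis
    using s t \<open>s \<noteq> t\<close> by (auto simp: insert_commute)
qed

text \<open>
  The main restriction on edges that meet a vertex set \<open>X\<close> in one point: if they share the outside
  point \<open>u\<close> and leave \<open>X\<close> through two points of a common edge inside \<open>X\<close>, they have the same second
  outside point, since otherwise \<open>s\<close>, \<open>t\<close>, \<open>u\<close> is the core of a loose triangle.
\<close>

lemma crossing_edges_share_vertex:
  assumes "loose_triangle_free H" "{s,t,r} \<in> H" "{s,u,v} \<in> H" "{t,u,w} \<in> H"
    "s \<in> X" "t \<in> X" "r \<in> X" "u \<notin> X" "v \<notin> X" "w \<notin> X"
  shows "v = w"
proof (rule ccontr)
  assume "v \<noteq> w"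
  note d = loose_triangle_free_distinct[OF assms(1)]
  have "distinct [s,t,u,r,w,v]"
    using d[OF assms(2)] d[OF assms(3)] d[OF assms(4)] assms(5-) \<open>v \<noteq> w\<close> by auto
  then show False
    using loose_triangle_freeD[OF assms(1,2,4,3)] by blast
qed

lemma bipyramid_pair_covered:
  assumes bip: "bipyramid H p q a b c" and D: "D = {p,q,a,b,c}"
    and s: "s \<in> D" and t: "t \<in> D" and "s \<noteq> t" and pq: "\<not> (s \<in> {p,q} \<and> t \<in> {p,q})"
  shows "\<exists>r\<in>D. {s,t,r} \<in> H"
  using bip s t \<open>s \<noteq> t\<close> pq unfolding D bipyramid_def by (auto simp: insert_commute)

lemma bipyramid_crossing_edges_share_vertex:
  assumes ltf: "loose_triangle_free H" and bip: "bipyramid H p q a b c" and D: "D = {p,q,a,b,c}"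
    and s: "s \<in> D" and t: "t \<in> D" and "s \<noteq> t" and pq: "\<not> (s \<in> {p,q} \<and> t \<in> {p,q})"
    and out: "u \<notin> D" "v \<notin> D" "w \<notin> D" and e: "{s,u,v} \<in> H" "{t,u,w} \<in> H"
  shows "v = w"
proof -
  have "\<exists>r\<in>D. {s,t,r} \<in> H"
    by (rule bipyramid_pair_covered[OF bip D s t \<open>s \<noteq> t\<close> pq])
  then obtain r where "r \<in> D" "{s,t,r} \<in> H" by blast
  then show ?thesis
    using crossing_edges_share_vertex[OF ltf _ e, of r D] s t out by blast
qed

lemma tetrahedron_crossing_edges_share_vertex:
  assumes ltf: "loose_triangle_free H" and tet: "tetrahedron H a b c d" and K: "K = {a,b,c,d}"
    and s: "s \<in> K" and t: "t \<in> K" and "s \<noteq> t"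
    and out: "u \<notin> K" "v \<notin> K" "w \<notin> K" and e: "{s,u,v} \<in> H" "{t,u,w} \<in> H"
  shows "v = w"
proof -
  have "\<exists>r\<in>K. {s,t,r} \<in> H"
    using tet s t \<open>s \<noteq> t\<close> unfolding K tetrahedron_def by (auto simp: insert_commute)
  then obtain r where "r \<in> K" "{s,t,r} \<in> H" by blast
  then show ?thesis
    using crossing_edges_share_vertex[OF ltf _ e, of r K] s t out by blast
qed

lemma tetrahedron_adjacent_extensions:
  assumes ltf: "loose_triangle_free H" and tet: "tetrahedron H a b c d"
    and "u \<notin> {a,b,c,d}" "v \<notin> {a,b,c,d}" "{a,b,u} \<in> H" "{a,c,v} \<in> H"
  shows "u = v"
proof (rule ccontr)
  assume "u \<noteq> v"
  then show False
    using loose_triangle_freeD[OF ltf, of b a u c v d] assms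
    by (auto simp: tetrahedron_def insert_commute)
qed

lemma tetrahedron_extension_blocks_crossing_edge:
  assumes ltf: "loose_triangle_free H" and tet: "tetrahedron H a b c d"
    and "u \<notin> {a,b,c,d}" "{a,b,u} \<in> H" "v \<notin> {a,b,c,d}"
  shows "{c,u,v} \<notin> H" "{d,u,v} \<notin> H"
proof -
  have *: "{d,u,v} \<notin> H" if "tetrahedron H a b c d" "u \<notin> {a,b,c,d}" "{a,b,u} \<in> H" "v \<notin> {a,b,c,d}"
    for a b c d
  proof
    assume e: "{d,u,v} \<in> H"
    then have "u \<noteq> v" using loose_triangle_free_distinct[OF ltf] by blast
    then show False
      using loose_triangle_freeD[OF ltf, of d u v b a c] that e
      by (auto simp: tetrahedron_def insert_commute)
  qed
  show "{d,u,v} \<notin> H" using * assms by blast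
  show "{c,u,v} \<notin> H" using *[OF tetrahedron_commute(3)[OF tet]] assms by auto
qed

text \<open>
  Only the opposite pairs \<open>{a,b}\<close> and \<open>{c,d}\<close> of the tetrahedron may lie in edges that leave it, so
  that the other four pairs are private to its four edges.
\<close>

definition two_sided :: "'a set set \<Rightarrow> 'a \<Rightarrow> 'a \<Rightarrow> 'a \<Rightarrow> 'a \<Rightarrow> bool" where
  "two_sided H a b c d \<longleftrightarrow> (\<forall>u. u \<notin> {a,b,c,d} \<longrightarrow>
     {a,c,u} \<notin> H \<and> {a,d,u} \<notin> H \<and> {b,c,u} \<notin> H \<and> {b,d,u} \<notin> H)"

text \<open>
  The complementary situation: two pairs of the tetrahedron that share the corner \<open>a\<close> are
  extended by the same outside point.
\<close>

definition cornered :: "'a set set \<Rightarrow> 'a \<Rightarrow> 'a \<Rightarrow> 'a \<Rightarrow> 'a \<Rightarrow> 'a \<Rightarrow> bool" where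
  "cornered H a b c d u \<longleftrightarrow> u \<notin> {a,b,c,d} \<and> {a,b,u} \<in> H \<and> {a,c,u} \<in> H"

text \<open>
  By \<open>tetrahedron_adjacent_extensions\<close>, two adjacent pairs of the tetrahedron can
  be extended only by the same point, which makes the tetrahedron cornered. Otherwise the extended pairs are pairwise disjoint,
  hence contained in one of the three perfect matchings of the four vertices.
\<close>

lemma tetrahedron_two_sided_or_cornered:
  assumes ltf: "loose_triangle_free H" and tet: "tetrahedron H a b c d"
  shows "(\<exists>a b c d. tetrahedron H a b c d \<and> two_sided H a b c d)
    \<or> (\<exists>a b c d u. tetrahedron H a b c d \<and> cornered H a b c d u)"
proof (rule ccontr)
  assume contr: "\<not> ?thesis"
  define ext where "ext p q \<longleftrightarrow> (\<exists>u. u \<notin> {a,b,c,d} \<and> {p,q,u} \<in> H)" for p q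
  have comm: "ext p q \<longleftrightarrow> ext q p" for p q
    by (simp add: ext_def insert_commute)
  have adj: "\<not> (ext p q \<and> ext p r)" if t: "tetrahedron H p q r s" and K: "{p,q,r,s} = {a,b,c,d}"
    for p q r s
  proof
    assume "ext p q \<and> ext p r"
    then obtain u v where "u \<notin> {p,q,r,s}" "v \<notin> {p,q,r,s}" "{p,q,u} \<in> H" "{p,r,v} \<in> H"
      unfolding ext_def K by blast
    then have "cornered H p q r s u"
      using tetrahedron_adjacent_extensions[OF ltf t] unfolding cornered_def by metis
    then show False using t contr by blast
  qed
  have t: "tetrahedron H a b c d" "tetrahedron H a b d c" "tetrahedron H a c d b"
    "tetrahedron H b a c d" "tetrahedron H b a d c" "tetrahedron H b c d a"
    "tetrahedron H c a b d" "tetrahedron H c a d b" "tetrahedron H c b d a"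
    "tetrahedron H d a b c" "tetrahedron H d a c b" "tetrahedron H d b c a"
    using tet unfolding tetrahedron_def by (auto simp: insert_commute)
  have no_adj: "\<not> (ext a b \<and> ext a c)" "\<not> (ext a b \<and> ext a d)" "\<not> (ext a c \<and> ext a d)"
    "\<not> (ext b a \<and> ext b c)" "\<not> (ext b a \<and> ext b d)" "\<not> (ext b c \<and> ext b d)"
    "\<not> (ext c a \<and> ext c b)" "\<not> (ext c a \<and> ext c d)" "\<not> (ext c b \<and> ext c d)"
    "\<not> (ext d a \<and> ext d b)" "\<not> (ext d a \<and> ext d c)" "\<not> (ext d b \<and> ext d c)"
    by (rule adj[OF t(1)] adj[OF t(2)] adj[OF t(3)] adj[OF t(4)] adj[OF t(5)] adj[OF t(6)]
        adj[OF t(7)] adj[OF t(8)] adj[OF t(9)] adj[OF t(10)] adj[OF t(11)] adj[OF t(12)]; blast)+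
  have two: "two_sided H p q r s"
    if "{p,q,r,s} = {a,b,c,d}" "\<not> ext p r" "\<not> ext p s" "\<not> ext q r" "\<not> ext q s" for p q r s
    using that unfolding two_sided_def ext_def by blast
  have "two_sided H a b c d \<or> two_sided H a c b d \<or> two_sided H a d b c"
  proof (cases "ext a b \<or> ext c d")
    case True
    then have "two_sided H a b c d"
      using no_adj comm by (intro two) blast+
    then show ?thesis by blast
  next
    case F: False
    show ?thesis
    proof (cases "ext a c \<or> ext b d")
      case True
      then have "two_sided H a c b d"
        using F no_adj comm by (intro two) blast+
      then show ?thesis by blast
    next
      case False
      then have "two_sided H a d b c"
        using F comm by (intro two) blast+
      then show ?thesis by blast
    qed
  qed
  then show False
    using contr tet tetrahedron_commute(2)[OF tet] tetrahedron_commute(2)[OF tetrahedron_commute(3)[OF tet]]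
    by blast
qed

text \<open>
  Every pair of the tetrahedron shares exactly one vertex with \<open>{a,b}\<close> or with \<open>{a,c}\<close>, both of
  which are extended by \<open>u\<close>.
\<close>

lemma cornered_extension_unique:
  assumes ltf: "loose_triangle_free H" and tet: "tetrahedron H a b c d" and cor: "cornered H a b c d u"
    and K: "K = {a,b,c,d}" and st: "s \<in> K" "t \<in> K" "s \<noteq> t" and v: "v \<notin> K" "{s,t,v} \<in> H"
  shows "v = u"
proof -
  have u: "u \<notin> {a,b,c,d}" "{a,b,u} \<in> H" "{a,c,u} \<in> H"
    using cor by (auto simp: cornered_def)
  note adj = tetrahedron_adjacent_extensions[OF ltf]
  have t: "tetrahedron H a b c d" "tetrahedron H a b d c" "tetrahedron H a c d b"
    "tetrahedron H b a c d" "tetrahedron H b a d c" "tetrahedron H c a d b" "tetrahedron H a c b d"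
    using tet unfolding tetrahedron_def by (auto simp: insert_commute)
  have v': "v \<notin> {a,b,c,d}" using v K by simp
  have "{a,b,v} \<in> H \<longrightarrow> v = u" "{a,c,v} \<in> H \<longrightarrow> v = u" "{a,d,v} \<in> H \<longrightarrow> v = u"
    "{b,c,v} \<in> H \<longrightarrow> v = u" "{b,d,v} \<in> H \<longrightarrow> v = u" "{c,d,v} \<in> H \<longrightarrow> v = u"
    using adj[OF t(7), of u v] adj[OF t(1), of u v] adj[OF t(2), of u v] adj[OF t(4), of u v]
      adj[OF t(5), of u v] adj[OF t(6), of u v] u v' by (auto simp: insert_commute)
  then show ?thesis
    using st v(2) unfolding K by (auto simp: insert_commute)
qed

lemma cornered_crossing_edge_at_corner:
  assumes ltf: "loose_triangle_free H" and tet: "tetrahedron H a b c d" and cor: "cornered H a b c d u"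
    and K: "K = {a,b,c,d}" and s: "s \<in> K" and v: "v \<notin> K" "{s,u,v} \<in> H"
  shows "s = a"
proof -
  have u: "u \<notin> {a,b,c,d}" "{a,b,u} \<in> H" "{a,c,u} \<in> H"
    using cor by (auto simp: cornered_def)
  note t' = tetrahedron_commute(2)[OF tet]
  have "{c,u,v} \<notin> H" "{d,u,v} \<notin> H" "{b,u,v} \<notin> H"
    using tetrahedron_extension_blocks_crossing_edge[OF ltf tet, of u v]
      tetrahedron_extension_blocks_crossing_edge[OF ltf t', of u v] u v K by auto
  then show ?thesis
    using s v K by auto
qed

text \<open>
  A third pair extended by \<open>u\<close> contains \<open>d\<close>, because three pairs forming a triangle would make
  \<open>u\<close> and the fourth vertex the apexes of a bipyramid. Of the pairs containing \<open>d\<close> at most one can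
  occur: two of them would complete a triangle or a four-cycle, and a four-cycle \<open>a b d c\<close> yields
  the bipyramid with apexes \<open>a\<close> and \<open>d\<close>.
\<close>

lemma cornered_edges_at_apex:
  assumes tet: "tetrahedron H a b c d" and cor: "cornered H a b c d u"
    and nb: "\<nexists>p q a b c. bipyramid H p q a b c"
  shows "\<exists>P. \<forall>s t. {s,t} \<subseteq> {a,b,c,d} \<longrightarrow> s \<noteq> t \<longrightarrow> {s,t,u} \<in> H \<longrightarrow>
    {s,t,u} \<in> {{a,b,u},{a,c,u},P}"
proof -
  have u: "u \<notin> {a,b,c,d}" "{a,b,u} \<in> H" "{a,c,u} \<in> H"
    using cor by (auto simp: cornered_def)
  have "\<not> bipyramid H d u a b c" "\<not> bipyramid H c u a b d" "\<not> bipyramid H b u a c d"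
    "\<not> bipyramid H a d b c u"
    using nb by blast+
  then have n: "{b,c,u} \<notin> H" "\<not> ({a,d,u} \<in> H \<and> {b,d,u} \<in> H)" "\<not> ({a,d,u} \<in> H \<and> {c,d,u} \<in> H)"
    "\<not> ({b,d,u} \<in> H \<and> {c,d,u} \<in> H)"
    using u tet unfolding bipyramid_def tetrahedron_def by (auto simp: insert_commute)
  \<comment> \<open>At most one of these three is an edge; the last alternative is also the value when none is.\<close>
  define P where "P = (if {a,d,u} \<in> H then {a,d,u} else if {b,d,u} \<in> H then {b,d,u} else {c,d,u})"
  have P: "{a,d,u} \<in> H \<longrightarrow> P = {a,d,u}" "{b,d,u} \<in> H \<longrightarrow> P = {b,d,u}"
    "{c,d,u} \<in> H \<longrightarrow> P = {c,d,u}"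
    using n(2-4) unfolding P_def by meson+
  have "{s,t,u} \<in> {{a,b,u},{a,c,u},P}"
    if st: "{s,t} \<subseteq> {a,b,c,d}" "s \<noteq> t" and e: "{s,t,u} \<in> H" for s t
  proof -
    define Q where "Q X \<longleftrightarrow> (X \<in> H \<longrightarrow> X \<in> {{a,b,u},{a,c,u},P})" for X
    have "Q {a,b,u}" "Q {a,c,u}" "Q {a,d,u}" "Q {b,c,u}" "Q {b,d,u}" "Q {c,d,u}"
      unfolding Q_def using n(1) P by simp_all
    then have "Q {s,t,u}"
      using st by (auto simp: insert_commute)
    then show ?thesis
      using e unfolding Q_def by blast
  qed
  then show ?thesis by blast
qed

section \<open>The number of triples is at most the size of the shadow\<close>

text \<open>
  Both upper bounds for triple systems start from this distinction between independence modulo two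
  and the three kinds of clusters that can be deleted.
\<close>

lemma even_family_cluster_cases:
  assumes ltf: "loose_triangle_free H"
  obtains (even_free) "\<And>C. C \<subseteq> H \<Longrightarrow> even_family C \<Longrightarrow> C = {}"
    | (bip) p q a b c where "bipyramid H p q a b c"
    | (two) a b c d where "tetrahedron H a b c d" "two_sided H a b c d"
    | (cor) a b c d u where "tetrahedron H a b c d" "cornered H a b c d u"
        "\<nexists>p q a b c. bipyramid H p q a b c"
proof (cases "\<exists>C\<subseteq>H. even_family C \<and> C \<noteq> {}")
  case False
  then show thesis using even_free by blast
next
  case True
  then obtain C where C: "C \<subseteq> H" "even_family C" "C \<noteq> {}" by blast
  have "(\<exists>a b c d. tetrahedron C a b c d) \<or> (\<exists>p q a b c. bipyramid C p q a b c)"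
    using even_family_contains_tetrahedron_or_bipyramid loose_triangle_free_subset[OF ltf C(1)] C
    by blast
  then have "(\<exists>a b c d. tetrahedron H a b c d) \<or> (\<exists>p q a b c. bipyramid H p q a b c)"
    using C(1) unfolding tetrahedron_def bipyramid_def by blast
  then show thesis
    using tetrahedron_two_sided_or_cornered[OF ltf] bip two cor by metis
qed

lemma card_le_shadow_by_removal:
  assumes ltf: "loose_triangle_free H" and "S \<subseteq> H" "Q \<subseteq> shadow H"
    and priv: "Q \<inter> shadow (H - S) = {}" and le: "card S \<le> card Q"
    and rest: "card (H - S) \<le> card (shadow (H - S))"
  shows "card H \<le> card (shadow H)"
proof -
  have fin: "finite S" "finite (shadow H)"
    using assms(2) ltf finite_subset finite_shadow[OF ltf] by (auto simp: loose_triangle_free_def)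
  have "shadow (H - S) \<subseteq> shadow H"
    by (auto simp: shadow_def)
  then have "card Q + card (shadow (H - S)) \<le> card (shadow H)"
    using priv \<open>Q \<subseteq> shadow H\<close> fin
    by (metis Un_least card_Un_disjoint card_mono finite_subset)
  moreover have "card H = card S + card (H - S)"
    using fin(1) \<open>S \<subseteq> H\<close> by (metis card_Diff_subset card_mono le_add_diff_inverse
        ltf loose_triangle_free_def)
  ultimately show ?thesis using le rest by linarith
qed

text \<open>
  At least nine of the ten pairs of \<open>D\<close> are covered. The remaining pair is that of the apexes; if
  it is not covered, at most seven triples are possible.
\<close>

lemma bipyramid_card_le_shadow:
  assumes ltf: "loose_triangle_free H" and bip: "bipyramid H p q a b c" and D: "D = {p,q,a,b,c}"
  shows "card (H \<inter> Pow D) \<le> card (shadow (H \<inter> Pow D))"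
proof -
  let ?S = "H \<inter> Pow D" and ?T = "{a,b,c}"
  have dist: "distinct [p,q,a,b,c]" using bip by (simp add: bipyramid_def)
  have ltfS: "loose_triangle_free ?S"
    using ltf loose_triangle_free_subset by blast
  note fin = finite_shadow[OF ltfS]
  have cD: "finite D" "card D = 5" using dist by (simp_all add: D)
  have S3: "?S \<subseteq> nsets D 3"
    using ltf by (auto simp: nsets_def loose_triangle_free_def finite_subset D)
  have sub: "nsets D 2 - {{p,q}} \<subseteq> shadow ?S"
  proof
    fix P assume P: "P \<in> nsets D 2 - {{p,q}}"
    then obtain s t where st: "P = {s,t}" "s \<in> D" "t \<in> D" "s \<noteq> t"
      using nsets2_E by blast
    have "\<not> (s \<in> {p,q} \<and> t \<in> {p,q})"
      using P st by (auto simp: insert_commute)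
    then obtain r where "r \<in> D" "{s,t,r} \<in> H"
      using bipyramid_pair_covered[OF bip D] st by blast
    then show "P \<in> shadow ?S"
      using st mem_shadow_iff[OF ltfS, of s t] by blast
  qed
  have pq: "{p,q} \<in> nsets D 2" using dist by (simp add: D)
  show ?thesis
  proof (cases "{p,q} \<in> shadow ?S")
    case True
    then have "card (nsets D 2) \<le> card (shadow ?S)"
      using sub fin by (intro card_mono) auto
    moreover have "card ?S \<le> card (nsets D 3)"
      using S3 cD by (intro card_mono) (auto simp: finite_imp_finite_nsets)
    moreover have "(5::nat) choose 2 = 10" "(5::nat) choose 3 = 10"
      by (simp_all add: numeral_eq_Suc)
    ultimately show ?thesis using cD by simp
  next
    case False
    have "?S \<subseteq> {?T} \<union> insert p ` nsets ?T 2 \<union> insert q ` nsets ?T 2"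
    proof
      fix e assume e: "e \<in> ?S"
      then have e3: "card e = 3" "e \<subseteq> D" and fe: "finite e"
        using S3 by (auto simp: nsets_def)
      have npq: "\<not> {p,q} \<subseteq> e"
        using False e pq by (auto simp: shadow_def nsets_def)
      have side: "e \<in> insert x ` nsets ?T 2" if "x \<in> e" "e - {x} \<subseteq> ?T" for x
      proof -
        have "e - {x} \<in> nsets ?T 2"
          using that e3 fe by (simp add: nsets_def)
        then show ?thesis using that(1) by (metis imageI insert_Diff)
      qed
      consider "p \<in> e" "q \<notin> e" | "p \<notin> e" "q \<in> e" | "p \<notin> e" "q \<notin> e"
        using npq by blast
      then show "e \<in> {?T} \<union> insert p ` nsets ?T 2 \<union> insert q ` nsets ?T 2"
      proof cases
        case 1
        then show ?thesis using side[of p] e3 D by blast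
      next
        case 2
        then show ?thesis using side[of q] e3 D by blast
      next
        case 3
        then have "e \<subseteq> ?T" using e3 D by blast
        then have "e = ?T" using e3 dist by (intro card_subset_eq) auto
        then show ?thesis by blast
      qed
    qed
    then have "card ?S \<le> card ({?T} \<union> insert p ` nsets ?T 2 \<union> insert q ` nsets ?T 2)"
      by (intro card_mono) (auto simp: finite_imp_finite_nsets)
    also have "\<dots> \<le> card {?T} + card (insert p ` nsets ?T 2) + card (insert q ` nsets ?T 2)"
      by (meson add_le_mono1 card_Un_le le_trans)
    also have "\<dots> \<le> 1 + card (nsets ?T 2) + card (nsets ?T 2)"
      by (intro add_mono card_image_le finite_imp_finite_nsets) auto
    also have "\<dots> = 7"
    proof -
      have "card ?T = 3" using dist by simp
      moreover have "(3::nat) choose 2 = 3" by (simp add: numeral_eq_Suc)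
      ultimately show ?thesis by simp
    qed
    finally have "card ?S \<le> 7" .
    moreover have "card (nsets D 2 - {{p,q}}) = 9"
    proof -
      have "(5::nat) choose 2 = 10" by (simp add: numeral_eq_Suc)
      then show ?thesis using pq cD by (simp add: finite_imp_finite_nsets)
    qed
    moreover have "card (nsets D 2 - {{p,q}}) \<le> card (shadow ?S)"
      using sub fin by (rule card_mono[rotated])
    ultimately show ?thesis by linarith
  qed
qed

lemma bipyramid_shadow_private:
  assumes ltf: "loose_triangle_free H" and bip: "bipyramid H p q a b c" and D: "D = {p,q,a,b,c}"
    and P: "P \<subseteq> D"
  shows "P \<notin> shadow (H - Pow D)"
proof
  assume "P \<in> shadow (H - Pow D)"
  then obtain s t where st: "P = {s,t}" "s \<noteq> t" and "{s,t} \<in> shadow (H - Pow D)"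
    by (auto simp: shadow_def card_2_iff)
  moreover have "loose_triangle_free (H - Pow D)"
    using ltf loose_triangle_free_subset by blast
  ultimately obtain r where r: "{s,t,r} \<in> H" "\<not> {s,t,r} \<subseteq> D"
    using mem_shadow_iff by fastforce
  then have "r \<notin> D" using P st by auto
  then show False
    using bipyramid_no_edge_meets_in_two[OF ltf bip, of s t r] st P r D by auto
qed

lemma two_sided_shadow_private:
  assumes ltf: "loose_triangle_free H" and two: "two_sided H a b c d" and K: "K = {a,b,c,d}"
    and P: "P \<in> {{a,c},{a,d},{b,c},{b,d}}"
  shows "P \<notin> shadow (H - Pow K)"
proof -
  have ltf': "loose_triangle_free (H - Pow K)"
    using ltf loose_triangle_free_subset by blast
  have "{s,t} \<notin> shadow (H - Pow K)" if "s \<in> {a,b}" "t \<in> {c,d}" for s t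
  proof
    assume "{s,t} \<in> shadow (H - Pow K)"
    then obtain r where r: "{s,t,r} \<in> H" "\<not> {s,t,r} \<subseteq> K"
      using mem_shadow_iff[OF ltf'] by blast
    then have "r \<notin> K" using that K by auto
    then show False
      using two r(1) that unfolding two_sided_def K by auto
  qed
  then show ?thesis using P by auto
qed

lemma cornered_shadow_private:
  assumes ltf: "loose_triangle_free H" and tet: "tetrahedron H a b c d" and cor: "cornered H a b c d u"
    and D: "D = {a,b,c,d,u}"
    and P: "s \<in> {a,b,c,d} \<and> t \<in> {a,b,c,d} \<or> s \<in> {b,c,d} \<and> t = u"
  shows "{s,t} \<notin> shadow (H - Pow D)"
proof
  have ltf': "loose_triangle_free (H - Pow D)"
    using ltf loose_triangle_free_subset by blast
  assume "{s,t} \<in> shadow (H - Pow D)"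
  then obtain r where r: "{s,t,r} \<in> H" "\<not> {s,t,r} \<subseteq> D"
    using mem_shadow_iff[OF ltf'] by blast
  then have rD: "r \<notin> D" using P D by auto
  note ne = loose_triangle_free_distinct[OF ltf r(1)]
  from P show False
  proof
    assume "s \<in> {a,b,c,d} \<and> t \<in> {a,b,c,d}"
    then have "r = u"
      using cornered_extension_unique[OF ltf tet cor refl, of s t r] ne r rD D by blast
    then show False using rD D by blast
  next
    assume *: "s \<in> {b,c,d} \<and> t = u"
    then have "s = a"
      using cornered_crossing_edge_at_corner[OF ltf tet cor refl, of s r] r rD D by blast
    then show False using * tet by (auto simp: tetrahedron_def)
  qed
qed

text \<open>
  Together with the at most four triples of the tetrahedron itself this gives at most seven edges on
  its vertices and \<open>u\<close>, against which seven private pairs can be found.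
\<close>

lemma cornered_card_le:
  assumes ltf: "loose_triangle_free H" and tet: "tetrahedron H a b c d" and cor: "cornered H a b c d u"
    and nb: "\<nexists>p q a b c. bipyramid H p q a b c"
  shows "card {e\<in>H. e \<subseteq> {a,b,c,d,u} \<and> u \<in> e} \<le> 3"
proof -
  obtain P where P: "\<forall>s t. {s,t} \<subseteq> {a,b,c,d} \<longrightarrow> s \<noteq> t \<longrightarrow> {s,t,u} \<in> H \<longrightarrow>
    {s,t,u} \<in> {{a,b,u},{a,c,u},P}"
    using cornered_edges_at_apex[OF tet cor nb] ..
  have "{e\<in>H. e \<subseteq> {a,b,c,d,u} \<and> u \<in> e} \<subseteq> {{a,b,u},{a,c,u},P}"
  proof
    fix e assume e: "e \<in> {e\<in>H. e \<subseteq> {a,b,c,d,u} \<and> u \<in> e}"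
    then have "card e = 3" using ltf by (auto simp: loose_triangle_free_def)
    then have "card (e - {u}) = 2"
      using e by (simp add: card_ge_0_finite)
    then obtain s t where st: "e - {u} = {s,t}" "s \<noteq> t"
      by (auto simp: card_2_iff)
    then have e': "e = {s,t,u}" using e by blast
    have "{s,t} \<subseteq> {a,b,c,d}" using st(1) e by blast
    moreover have "{s,t,u} \<in> H" using e e' by simp
    ultimately show "e \<in> {{a,b,u},{a,c,u},P}"
      unfolding e' using P st(2) by simp
  qed
  then have "card {e\<in>H. e \<subseteq> {a,b,c,d,u} \<and> u \<in> e} \<le> card {{a,b,u},{a,c,u},P}"
    by (intro card_mono) auto
  also have "\<dots> \<le> 3"
    by (simp add: card_insert_if)
  finally show ?thesis .
qed

lemma card_triples_in_four:
  assumes "\<And>e. e \<in> H \<Longrightarrow> card e = 3" "distinct [a,b,c,d]"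
  shows "card (H \<inter> Pow {a,b,c,d}) \<le> 4"
proof -
  have "H \<inter> Pow {a,b,c,d} \<subseteq> nsets {a,b,c,d} 3"
    using assms(1) by (auto simp: nsets_def finite_subset)
  then have "card (H \<inter> Pow {a,b,c,d}) \<le> card (nsets {a,b,c,d} 3)"
    by (intro card_mono finite_imp_finite_nsets) auto
  moreover have "(4::nat) choose 3 = 4" by (simp add: numeral_eq_Suc)
  moreover have "card {a,b,c,d} = 4" using assms(2) by simp
  ultimately show ?thesis by simp
qed

text \<open>
  A family without even subfamilies is independent over the two-element field, so it is no larger
  than its shadow. Otherwise there is a tetrahedron or a bipyramid, and the edges on a suitable set
  \<open>D\<close> of four or five points cover at least as many pairs that no other edge covers; deleting these
  edges reduces the claim to a smaller family. If all pairs are covered, this bound exceeds the sharp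
  one by the number of points minus one, but it holds for any number of points.
\<close>

lemma card_le_card_shadow:
  assumes "loose_triangle_free H"
  shows "card H \<le> card (shadow H)"
  using assms
proof (induction "card H" arbitrary: H rule: less_induct)
  case less
  note ltf = less.prems
  have fin: "finite H" and c3: "\<And>e. e \<in> H \<Longrightarrow> card e = 3"
    using ltf by (auto simp: loose_triangle_free_def)
  have remove: "card H \<le> card (shadow H)"
    if "H \<inter> Pow D \<noteq> {}" "Q \<subseteq> shadow H" "Q \<inter> shadow (H - Pow D) = {}" "card (H \<inter> Pow D) \<le> card Q"
    for D :: "'a set" and Q :: "'a set set"
  proof (rule card_le_shadow_by_removal[OF ltf])
    have eq: "H - H \<inter> Pow D = H - Pow D" by blast
    show "H \<inter> Pow D \<subseteq> H" by blast
    show "Q \<subseteq> shadow H" "card (H \<inter> Pow D) \<le> card Q" by (fact that)+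
    show "Q \<inter> shadow (H - H \<inter> Pow D) = {}" using that eq by simp
    have "H - Pow D \<subset> H" using that(1) by blast
    then have "card (H - Pow D) < card H" using fin by (rule psubset_card_mono[rotated])
    moreover have "loose_triangle_free (H - Pow D)"
      using ltf loose_triangle_free_subset by blast
    ultimately show "card (H - H \<inter> Pow D) \<le> card (shadow (H - H \<inter> Pow D))"
      unfolding eq by (rule less.hyps)
  qed
  show ?case
    using ltf
  proof (cases rule: even_family_cluster_cases)
    case even_free
    then show ?thesis using card_le_shadow_if_no_even_family[OF ltf] by blast
  next
    case (bip p q a b c)
    define D where "D = {p,q,a,b,c}"
    have "{p,a,b} \<in> H \<inter> Pow D" using bip by (auto simp: bipyramid_def D_def)
    then show ?thesis
      using bipyramid_card_le_shadow[OF ltf bip D_def] bipyramid_shadow_private[OF ltf bip D_def]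
      by (intro remove[where D = D and Q = "shadow (H \<inter> Pow D)"]) (auto simp: shadow_def)
  next
    case (two a b c d)
    define K where "K = {a,b,c,d}"
    define Q where "Q = {{a,c},{a,d},{b,c},{b,d}}"
    have dist: "distinct [a,b,c,d]" using two(1) by (simp add: tetrahedron_def)
    show ?thesis
    proof (rule remove)
      show "H \<inter> Pow K \<noteq> {}" using two(1) by (auto simp: tetrahedron_def K_def)
      show "Q \<subseteq> shadow H"
        using two(1) pairs_of_triple_in_shadow[OF ltf, of a c d]
          pairs_of_triple_in_shadow[OF ltf, of b c d] unfolding Q_def tetrahedron_def by simp
      show "Q \<inter> shadow (H - Pow K) = {}"
        using two_sided_shadow_private[OF ltf two(2) K_def] unfolding Q_def by blast
      have "card Q = 4" using dist by (simp add: Q_def doubleton_eq_iff)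
      then show "card (H \<inter> Pow K) \<le> card Q"
        using card_triples_in_four[of H, OF c3 dist] by (simp add: K_def)
    qed
  next
    case (cor a b c d u)
    define D where "D = {a,b,c,d,u}"
    \<comment> \<open>The pair \<open>{a,u}\<close> is left out, since edges at the corner may leave \<open>D\<close>; seven pairs suffice.\<close>
    define Q where "Q = {{a,b},{a,c},{a,d},{b,c},{b,d},{c,d},{b,u}}"
    have dist4: "distinct [a,b,c,d]" using cor(1) by (simp add: tetrahedron_def)
    have dist: "distinct [a,b,c,d,u]" using cor(1,2) by (auto simp: tetrahedron_def cornered_def)
    show ?thesis
    proof (rule remove)
      show "H \<inter> Pow D \<noteq> {}" using cor(1) by (auto simp: tetrahedron_def D_def)
      show "Q \<subseteq> shadow H"
        using cor(1,2) pairs_of_triple_in_shadow[OF ltf, of a b c]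
          pairs_of_triple_in_shadow[OF ltf, of a c d] pairs_of_triple_in_shadow[OF ltf, of b c d]
          pairs_of_triple_in_shadow[OF ltf, of a b u]
        unfolding Q_def tetrahedron_def cornered_def by simp
      show "Q \<inter> shadow (H - Pow D) = {}"
        using cornered_shadow_private[OF ltf cor(1,2) D_def] unfolding Q_def by blast
      have "card Q = 7" using dist by (simp add: Q_def doubleton_eq_iff)
      moreover have "H \<inter> Pow D \<subseteq> (H \<inter> Pow {a,b,c,d}) \<union> {e\<in>H. e \<subseteq> {a,b,c,d,u} \<and> u \<in> e}"
        unfolding D_def by blast
      then have "card (H \<inter> Pow D) \<le> card (H \<inter> Pow {a,b,c,d}) + card {e\<in>H. e \<subseteq> {a,b,c,d,u} \<and> u \<in> e}"
        using fin by (intro order.trans[OF card_mono card_Un_le]) auto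
      ultimately show "card (H \<inter> Pow D) \<le> card Q"
        using card_triples_in_four[of H, OF c3 dist4] cornered_card_le[OF ltf cor] by auto
    qed
  qed
qed

section \<open>Charging edges to outside points\<close>

text \<open>
  For outside points \<open>u\<close> and \<open>v\<close>, the crossing edges \<open>{p,u,v}\<close> with \<open>p\<close> in \<open>X\<close> look like the blades
  of a fan with hinge \<open>{u,v}\<close>.
\<close>

definition crossing_fan :: "'a set set \<Rightarrow> 'a set \<Rightarrow> 'a \<Rightarrow> 'a \<Rightarrow> 'a set" where
  "crossing_fan H X u v = {p\<in>X. {p,u,v} \<in> H}"

text \<open>
  A fan with \<open>k\<close> blades, if kept, puts \<open>k\<close> pairs at each end of its hinge into the shadow; if deleted,
  it charges only \<open>k / 2\<close> to each end. Two pairs per outside point are affordable, so only fans with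
  three or more blades have to go. Smaller fans are kept, since their pairs may also be covered by
  other edges that are kept, and then deleting the fan would save nothing.
\<close>

definition big_fan_edges :: "'a set set \<Rightarrow> 'a set \<Rightarrow> 'a set set" where
  "big_fan_edges H X = {{p,u,v} | p u v. p \<in> crossing_fan H X u v \<and> u \<notin> X \<and> v \<notin> X \<and>
     3 \<le> card (crossing_fan H X u v)}"

lemma crossing_fan_commute: "crossing_fan H X u v = crossing_fan H X v u"
  by (simp add: crossing_fan_def insert_commute)

lemma big_fan_edges_subset: "big_fan_edges H X \<subseteq> H"
  by (auto simp: big_fan_edges_def crossing_fan_def)

lemma big_fan_edgesE:
  assumes "e \<in> big_fan_edges H X" "u \<in> e" "u \<notin> X"
  obtains p v where "e = {p,u,v}" "p \<in> crossing_fan H X u v" "v \<notin> X"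
    "3 \<le> card (crossing_fan H X u v)"
proof -
  obtain p u' v' where e: "e = {p,u',v'}" "p \<in> crossing_fan H X u' v'" "u' \<notin> X" "v' \<notin> X"
    "3 \<le> card (crossing_fan H X u' v')"
    using assms(1) by (auto simp: big_fan_edges_def)
  have "u = u' \<or> u = v'"
    using assms(2,3) e(1,2) by (auto simp: crossing_fan_def)
  then show thesis
  proof
    assume "u = u'"
    then show thesis using that e by blast
  next
    assume u: "u = v'"
    then have "e = {p,u,u'}" using e(1) by blast
    then show thesis
      using that[of p u'] e u crossing_fan_commute[of H X] by metis
  qed
qed

text \<open>
  The left-hand side is twice the charge of \<open>u\<close>: deleted fan edges count one half at each of their
  two outside points, and pairs \<open>{p,u}\<close> in the remaining shadow count one. If \<open>u\<close> lies in a big fan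
  with hinge \<open>{u,v}\<close>, then every crossing edge at \<open>u\<close> uses \<open>v\<close> and is deleted. If not, three
  different points of \<open>X\<close> on crossing edges at \<open>u\<close> would force a common second outside point and
  thus a big fan; so at most two pairs remain. The exceptional set \<open>Z\<close> accounts for the two apexes
  of a bipyramid, which need not lie in a common edge inside \<open>X\<close>.
\<close>

lemma fan_budget:
  assumes "finite X" and u: "u \<notin> X" and Z: "finite Z" "card Z \<le> 2"
    and share: "\<And>p q v w. p \<in> X \<Longrightarrow> q \<in> X \<Longrightarrow> p \<noteq> q \<Longrightarrow> \<not> (p \<in> Z \<and> q \<in> Z) \<Longrightarrow>
      v \<notin> X \<Longrightarrow> w \<notin> X \<Longrightarrow> {p,u,v} \<in> H \<Longrightarrow> {q,u,w} \<in> H \<Longrightarrow> v = w"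
  shows "card {e\<in>big_fan_edges H X. u \<in> e}
    + 2 * card {p\<in>X. \<exists>v. v \<notin> X \<and> {p,u,v} \<in> H - big_fan_edges H X} \<le> max (card X) 4"
proof (cases "\<exists>v. v \<notin> X \<and> 3 \<le> card (crossing_fan H X u v)")
  case True
  then obtain v where v: "v \<notin> X" "3 \<le> card (crossing_fan H X u v)" by blast
  let ?P = "crossing_fan H X u v"
  have PX: "?P \<subseteq> X" by (auto simp: crossing_fan_def)
  have unique: "w = v" if q: "q \<in> X" "w \<notin> X" "{q,u,w} \<in> H" for q w
  proof -
    have "\<exists>p\<in>?P. p \<noteq> q \<and> \<not> (p \<in> Z \<and> q \<in> Z)"
    proof (cases "q \<in> Z")
      case True
      have "\<not> ?P \<subseteq> Z"
        using v(2) Z(2) card_mono[OF Z(1), of ?P] by auto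
      then obtain p where "p \<in> ?P" "p \<notin> Z" by blast
      then show ?thesis using True by metis
    next
      case False
      have "\<not> ?P \<subseteq> {q}"
        using v(2) card_mono[of "{q}" ?P] by auto
      then show ?thesis using False by blast
    qed
    then obtain p where "p \<in> ?P" "p \<noteq> q" "\<not> (p \<in> Z \<and> q \<in> Z)" by blast
    then show ?thesis
      using share[of p q v w] q v(1) by (auto simp: crossing_fan_def)
  qed
  have "{e\<in>big_fan_edges H X. u \<in> e} \<subseteq> (\<lambda>p. {p,u,v}) ` X"
  proof
    fix e assume "e \<in> {e\<in>big_fan_edges H X. u \<in> e}"
    then obtain p w where "e = {p,u,w}" "p \<in> crossing_fan H X u w" "w \<notin> X"
      using big_fan_edgesE[of e H X u] u by (metis (no_types, lifting) mem_Collect_eq)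
    moreover from this have "w = v" using unique by (auto simp: crossing_fan_def)
    ultimately show "e \<in> (\<lambda>p. {p,u,v}) ` X" by (auto simp: crossing_fan_def)
  qed
  then have "card {e\<in>big_fan_edges H X. u \<in> e} \<le> card X"
    using \<open>finite X\<close> by (meson surj_card_le)
  moreover have "{p\<in>X. \<exists>w. w \<notin> X \<and> {p,u,w} \<in> H - big_fan_edges H X} = {}"
  proof -
    have False if "p \<in> X" "w \<notin> X" "{p,u,w} \<in> H - big_fan_edges H X" for p w
    proof -
      have "w = v" using unique that by blast
      then have "{p,u,w} \<in> big_fan_edges H X"
        using that v u unfolding big_fan_edges_def crossing_fan_def by blast
      then show False using that by blast
    qed
    then show ?thesis by blast
  qed
  ultimately show ?thesis
    by (simp only: card.empty mult_0_right add_0_right le_max_iff_disj simp_thms)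
next
  case False
  have "{e\<in>big_fan_edges H X. u \<in> e} = {}"
    using False u big_fan_edgesE[of _ H X u] by blast
  moreover have "card {p\<in>X. \<exists>v. v \<notin> X \<and> {p,u,v} \<in> H} \<le> 2" (is "card ?S \<le> 2")
  proof (rule ccontr)
    assume "\<not> card ?S \<le> 2"
    then have S: "3 \<le> card ?S" by simp
    then have "\<not> ?S \<subseteq> Z"
      using Z(2) card_mono[OF Z(1), of ?S] by auto
    then obtain s v where s: "s \<in> X" "s \<notin> Z" "v \<notin> X" "{s,u,v} \<in> H" by blast
    have "?S \<subseteq> crossing_fan H X u v"
    proof
      fix q assume "q \<in> ?S"
      then obtain w where w: "q \<in> X" "w \<notin> X" "{q,u,w} \<in> H" by blast
      then have "w = v" if "q \<noteq> s"
        using share[of s q v w] s that by blast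
      then show "q \<in> crossing_fan H X u v"
        using s w by (cases "q = s") (auto simp: crossing_fan_def)
    qed
    then have "card ?S \<le> card (crossing_fan H X u v)"
      using \<open>finite X\<close> by (intro card_mono) (auto simp: crossing_fan_def)
    then show False using False S s(3) by auto
  qed
  moreover have "card {p\<in>X. \<exists>v. v \<notin> X \<and> {p,u,v} \<in> H - big_fan_edges H X} \<le> card ?S"
    using \<open>finite X\<close> by (intro card_mono) auto
  ultimately show ?thesis
    by (simp only: card.empty add_0_left le_max_iff_disj) linarith
qed

text \<open>
  Splits \<open>H\<close> into a kept part \<open>H'\<close> and a deleted part. The kept part is bounded by its shadow, whose
  pairs lie inside \<open>X\<close>, outside \<open>X\<close>, or across; the deleted edges are counted at their outside
  points. Everything is doubled because a deleted edge with two outside points is charged half to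
  each of them.
\<close>

lemma card_le_local_charges:
  assumes ltf: "loose_triangle_free H" and V: "finite V" "H \<subseteq> nsets V 3" and X: "X \<subseteq> V"
    and H': "H' \<subseteq> H" "\<And>e. e \<in> H' \<Longrightarrow> \<not> e \<subseteq> X" "\<And>e. e \<in> H - H' \<Longrightarrow> e \<inter> X \<noteq> {}"
  shows "2 * card H \<le> 2 * card (H \<inter> Pow X) + 2 * card (shadow H' \<inter> Pow X)
    + card (V - X) * (card (V - X) - 1)
    + (\<Sum>u\<in>V-X. 2 * card {e\<in>H-H'. e - X = {u}} + card {e\<in>H-H'. u \<in> e \<and> card (e - X) = 2}
        + 2 * card {p\<in>X. {p,u} \<in> shadow H'})"
proof -
  let ?R = "V - X"
  let ?A = "{e\<in>H-H'. card (e - X) = 1}" and ?B = "{e\<in>H-H'. card (e - X) = 2}"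
  have finR: "finite ?R" and finX: "finite X" using V X finite_subset by auto
  have finH: "finite H" using ltf by (simp add: loose_triangle_free_def)
  have edge: "e \<subseteq> V" "card e = 3" "finite e" if "e \<in> H" for e
    using V(2) that by (auto simp: nsets_def)
  have ltf': "loose_triangle_free H'" using ltf H'(1) by (rule loose_triangle_free_subset)
  have "H \<subseteq> H' \<union> (H \<inter> Pow X) \<union> ?A \<union> ?B"
  proof
    fix e assume e: "e \<in> H"
    show "e \<in> H' \<union> (H \<inter> Pow X) \<union> ?A \<union> ?B"
    proof (cases "e \<in> H' \<or> e \<subseteq> X")
      case True then show ?thesis using e by blast
    next
      case False
      then have "card (e \<inter> X) \<noteq> 0" "card (e - X) \<noteq> 0"
        using H'(3)[of e] e edge(3)[OF e] by auto
      moreover have "card (e \<inter> X) + card (e - X) = 3"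
        using edge[OF e] card_Int_Diff by metis
      ultimately have "card (e - X) = 1 \<or> card (e - X) = 2" by linarith
      then show ?thesis using e False by blast
    qed
  qed
  then have "card H \<le> card (H' \<union> (H \<inter> Pow X) \<union> ?A \<union> ?B)"
    using finH H'(1) by (intro card_mono) (auto intro: finite_subset)
  also have "\<dots> \<le> card H' + card (H \<inter> Pow X) + card ?A + card ?B"
    by (meson add_le_mono1 card_Un_le le_trans)
  finally have split: "card H \<le> card H' + card (H \<inter> Pow X) + card ?A + card ?B" .
  have "?A \<subseteq> (\<Union>u\<in>?R. {e\<in>H-H'. e - X = {u}})"
  proof
    fix e assume e: "e \<in> ?A"
    then obtain u where "e - X = {u}" by (auto simp: card_1_singleton_iff)
    moreover from this have "u \<in> ?R" using e edge(1)[of e] by blast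
    ultimately show "e \<in> (\<Union>u\<in>?R. {e\<in>H-H'. e - X = {u}})" using e by blast
  qed
  then have "card ?A \<le> card (\<Union>u\<in>?R. {e\<in>H-H'. e - X = {u}})"
    using finR finH by (intro card_mono) auto
  also have "\<dots> \<le> (\<Sum>u\<in>?R. card {e\<in>H-H'. e - X = {u}})"
    using finR by (rule card_UN_le)
  finally have A: "card ?A \<le> (\<Sum>u\<in>?R. card {e\<in>H-H'. e - X = {u}})" .
  have "2 * card ?B = (\<Sum>u\<in>?R. card {e\<in>H-H'. u \<in> e \<and> card (e - X) = 2})"
  proof -
    have "(\<Sum>u\<in>?R. card {e\<in>?B. u \<in> e}) = 2 * card ?B"
    proof (rule sum_multicount)
      show "\<forall>e\<in>?B. card {u\<in>?R. u \<in> e} = 2"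
      proof
        fix e assume e: "e \<in> ?B"
        then have "{u\<in>?R. u \<in> e} = e - X" using edge(1)[of e] by blast
        then show "card {u\<in>?R. u \<in> e} = 2" using e by simp
      qed
    qed (use finR finH in auto)
    moreover have "{e\<in>?B. u \<in> e} = {e\<in>H-H'. u \<in> e \<and> card (e - X) = 2}" for u
      by blast
    ultimately show ?thesis by simp
  qed
  note B = this
  have "shadow H' \<subseteq> (shadow H' \<inter> Pow X) \<union> nsets ?R 2
      \<union> (\<Union>u\<in>?R. (\<lambda>p. {p,u}) ` {p\<in>X. {p,u} \<in> shadow H'})"
  proof
    fix P assume P: "P \<in> shadow H'"
    then obtain s t where st: "P = {s,t}" "s \<noteq> t" and "P \<subseteq> V"
      using edge(1) H'(1) by (auto simp: shadow_def card_2_iff) blast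
    then have V': "s \<in> V" "t \<in> V" by auto
    have *: "{t,s} \<in> shadow H'" "{s,t} \<in> shadow H'" using P st by (simp_all add: insert_commute)
    consider "s \<in> X" "t \<in> X" | "s \<notin> X" "t \<notin> X" | "s \<in> X" "t \<in> ?R" | "t \<in> X" "s \<in> ?R"
      using V' by blast
    then show "P \<in> (shadow H' \<inter> Pow X) \<union> nsets ?R 2
      \<union> (\<Union>u\<in>?R. (\<lambda>p. {p,u}) ` {p\<in>X. {p,u} \<in> shadow H'})"
    proof cases
      case 1 then show ?thesis using P st by simp
    next
      case 2 then show ?thesis using st V' by simp
    next
      case 3 then show ?thesis using st * by blast
    next
      case 4 then show ?thesis using st * by blast
    qed
  qed
  then have "card (shadow H') \<le> card ((shadow H' \<inter> Pow X) \<union> nsets ?R 2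
      \<union> (\<Union>u\<in>?R. (\<lambda>p. {p,u}) ` {p\<in>X. {p,u} \<in> shadow H'}))"
    using finR finX finite_shadow[OF ltf'] by (intro card_mono) (auto simp: finite_imp_finite_nsets)
  also have "\<dots> \<le> card (shadow H' \<inter> Pow X) + card (nsets ?R 2)
      + card (\<Union>u\<in>?R. (\<lambda>p. {p,u}) ` {p\<in>X. {p,u} \<in> shadow H'})"
    by (meson add_le_mono1 card_Un_le le_trans)
  also have "card (\<Union>u\<in>?R. (\<lambda>p. {p,u}) ` {p\<in>X. {p,u} \<in> shadow H'})
      \<le> (\<Sum>u\<in>?R. card {p\<in>X. {p,u} \<in> shadow H'})"
    using finR finX by (intro order.trans[OF card_UN_le] sum_mono card_image_le) auto
  finally have shadow: "card (shadow H') \<le> card (shadow H' \<inter> Pow X) + (card ?R choose 2)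
      + (\<Sum>u\<in>?R. card {p\<in>X. {p,u} \<in> shadow H'})"
    by simp
  have "2 * (card ?R choose 2) \<le> card ?R * (card ?R - 1)"
    by (simp add: choose_two)
  moreover have "card H' \<le> card (shadow H')"
    by (rule card_le_card_shadow[OF ltf'])
  ultimately show ?thesis
    using split A B shadow by (simp add: sum.distrib sum_distrib_left[symmetric])
qed

text \<open>
  Here \<open>r\<close> is the number of outside points and \<open>k\<close> the size of \<open>X\<close>. Choosing two of \<open>r + k - 1\<close>
  points leaves, after twice the pairs of outside points are subtracted, room for \<open>2 * k - 2\<close> per
  outside point and for the constant \<open>(k - 1) * (k - 2)\<close>.
\<close>

lemma card_le_choose_if_charges:
  assumes "m = r + k" "2 * h \<le> c + r * (r - 1) + s" "c + s \<le> (2 * k - 2) * r + (k - 1) * (k - 2)"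
    and "1 \<le> (r::nat)" "2 \<le> (k::nat)"
  shows "h \<le> (m - 1) choose 2"
proof -
  define i j where "i = r - 1" and "j = k - 2"
  then have rk: "r = Suc i" "k = Suc (Suc j)"
    using assms(4,5) by simp_all
  have "Suc i * i + (2 * j + 2) * Suc i + Suc j * j = (i + j + 2) * (i + j + 1)"
    unfolding Suc_eq_plus1 by algebra
  moreover have "2 * h \<le> c + Suc i * i + s" "c + s \<le> (2 * j + 2) * Suc i + Suc j * j"
    using assms(2,3) unfolding rk by simp_all
  ultimately have "2 * h \<le> (i + j + 2) * (i + j + 1)"
    by linarith
  then show ?thesis
    unfolding assms(1) rk by (simp add: choose_two)
qed

section \<open>The sharp bound for triple systems without loose triangles\<close>

lemma edge_with_one_vertex_outside:
  assumes "loose_triangle_free H" "e \<in> H" "e - X = {u}"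
  obtains s t where "e = {s,t,u}" "s \<in> X" "t \<in> X" "s \<noteq> t" "u \<notin> X"
proof -
  have "card e = 3" "finite e"
    using assms(1,2) by (auto simp: loose_triangle_free_def intro: card_ge_0_finite)
  then have "card (e \<inter> X) = 2"
    using assms(3) card_Int_Diff[of e X] by simp
  then obtain s t where st: "e \<inter> X = {s,t}" "s \<noteq> t"
    by (auto simp: card_2_iff)
  then have "e = {s,t,u}" using assms(3) by blast
  moreover have "s \<in> X" "t \<in> X" "u \<notin> X" using st(1) assms(3) by blast+
  ultimately show thesis using st(2) that by blast
qed

lemma big_fan_edge_outside:
  assumes "e \<in> big_fan_edges H X" "loose_triangle_free H"
  shows "card (e - X) = 2" "e \<inter> X \<noteq> {}"
proof -
  obtain p u v where e: "e = {p,u,v}" "p \<in> X" "u \<notin> X" "v \<notin> X" "{p,u,v} \<in> H"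
    using assms(1) by (auto simp: big_fan_edges_def crossing_fan_def)
  then have "e - X = {u,v}" by blast
  moreover have "u \<noteq> v" using loose_triangle_free_distinct[OF assms(2) e(5)] by blast
  ultimately show "card (e - X) = 2" "e \<inter> X \<noteq> {}" using e by auto
qed

lemma no_big_fan_edge_at:
  assumes "u \<notin> X" and S: "finite S" "card S \<le> 2"
    and cross: "\<And>p v. p \<in> X \<Longrightarrow> v \<notin> X \<Longrightarrow> {p,u,v} \<in> H \<Longrightarrow> p \<in> S"
  shows "{e\<in>big_fan_edges H X. u \<in> e} = {}"
proof -
  have False if e: "e \<in> big_fan_edges H X" "u \<in> e" for e
  proof -
    obtain v where v: "v \<notin> X" "3 \<le> card (crossing_fan H X u v)"
      using big_fan_edgesE[OF e \<open>u \<notin> X\<close>] by metis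
    then have "crossing_fan H X u v \<subseteq> S"
      using cross by (auto simp: crossing_fan_def)
    then have "card (crossing_fan H X u v) \<le> card S"
      using S(1) by (rule card_mono[rotated])
    then show False using v S by linarith
  qed
  then show ?thesis by blast
qed

lemma shadow_mono: "H' \<subseteq> H \<Longrightarrow> shadow H' \<subseteq> shadow H"
  by (auto simp: shadow_def)

text \<open>
  The ten triples on \<open>D\<close> contribute 20 to the doubled count and each of the \<open>r\<close> outside points at most
  5, while \<open>8 * r + 12\<close> is available. This suffices for \<open>r \<ge> 3\<close>. For \<open>r = 2\<close> every edge not inside
  \<open>D\<close> contains both outside points, so there are at most 15 edges.
\<close>

lemma card_le_choose_if_bipyramid:
  assumes ltf: "loose_triangle_free H" and V: "finite V" "H \<subseteq> nsets V 3" "7 \<le> card V"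
    and bip: "bipyramid H p q a b c"
  shows "card H \<le> (card V - 1) choose 2"
proof -
  define D where "D = {p,q,a,b,c}"
  have finD: "finite D" "card D = 5"
    using bip by (auto simp: bipyramid_def D_def)
  have edge: "e \<subseteq> V" "card e = 3" if "e \<in> H" for e
    using V(2) that by (auto simp: nsets_def)
  have DV: "D \<subseteq> V"
    using bip edge(1) unfolding bipyramid_def D_def by blast
  have V5: "card V = card (V - D) + 5"
    using DV finD V by (simp add: card_Diff_subset)
  note no_two = bipyramid_no_edge_meets_in_two[OF ltf bip, folded D_def]
  have inside: "card (H \<inter> Pow D) \<le> 10"
  proof -
    have "H \<inter> Pow D \<subseteq> nsets D 3"
      using edge finD by (auto simp: nsets_def finite_subset)
    then have "card (H \<inter> Pow D) \<le> card (nsets D 3)"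
      using finD by (intro card_mono) (auto simp: finite_imp_finite_nsets)
    moreover have "(5::nat) choose 3 = 10" by (simp add: numeral_eq_Suc)
    ultimately show ?thesis using finD by simp
  qed
  have one_out: "{e\<in>H. e - D = {u}} = {}" for u
  proof -
    have False if e: "e \<in> H" "e - D = {u}" for e
    proof (rule edge_with_one_vertex_outside[OF ltf e])
      fix s t assume "e = {s,t,u}" "s \<in> D" "t \<in> D" "s \<noteq> t" "u \<notin> D"
      then show False using no_two[of s t u] e(1) by simp
    qed
    then show ?thesis by blast
  qed
  show ?thesis
  proof (cases "card (V - D) = 2")
    case True
    then obtain u v where uv: "V - D = {u,v}" "u \<noteq> v" by (auto simp: card_2_iff)
    have "H \<subseteq> (H \<inter> Pow D) \<union> (\<lambda>p. {p,u,v}) ` D"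
    proof
      fix e assume e: "e \<in> H"
      have fe: "finite e" using edge(2)[OF e] by (simp add: card_ge_0_finite)
      show "e \<in> (H \<inter> Pow D) \<union> (\<lambda>p. {p,u,v}) ` D"
      proof (cases "e \<subseteq> D")
        case True then show ?thesis using e by blast
      next
        case False
        have "e - D \<subseteq> {u,v}" using edge(1)[OF e] uv(1) by blast
        moreover have "e - D \<noteq> {}" "e - D \<noteq> {u}" "e - D \<noteq> {v}"
          using False one_out e by blast+
        ultimately have eD: "e - D = {u,v}" by blast
        then have "card (e \<inter> D) = 1"
          using card_Int_Diff[OF fe, of D] edge(2)[OF e] uv(2) by simp
        then obtain x where "e \<inter> D = {x}" by (auto simp: card_1_singleton_iff)
        then have "e = {x,u,v}" "x \<in> D" using eD by blast+
        then show ?thesis by blast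
      qed
    qed
    then have "card H \<le> card ((H \<inter> Pow D) \<union> (\<lambda>p. {p,u,v}) ` D)"
      using finD by (intro card_mono) auto
    also have "\<dots> \<le> card (H \<inter> Pow D) + card ((\<lambda>p. {p,u,v}) ` D)"
      by (rule card_Un_le)
    also have "\<dots> \<le> 10 + 5"
      using inside card_image_le[OF finD(1), of "\<lambda>p. {p,u,v}"] finD(2) by (intro add_mono) simp_all
    also have "\<dots> = (card V - 1) choose 2"
      using V5 True by (simp add: choose_two)
    finally show ?thesis .
  next
    case False
    \<comment> \<open>At least three outside points: the charging argument applies.\<close>
    let ?M = "big_fan_edges H D"
    define H' where "H' = H - Pow D - ?M"
    have H'sub: "H' \<subseteq> H" "H' \<subseteq> H - Pow D" by (auto simp: H'_def)
    have ltf': "loose_triangle_free H'" using ltf H'sub(1) by (rule loose_triangle_free_subset)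
    have "shadow H' \<inter> Pow D = {}"
      using shadow_mono[OF H'sub(2)] bipyramid_shadow_private[OF ltf bip D_def] by blast
    moreover have "2 * card {e\<in>H-H'. e - D = {u}} + card {e\<in>H-H'. u \<in> e \<and> card (e - D) = 2}
        + 2 * card {x\<in>D. {x,u} \<in> shadow H'} \<le> 5" if u: "u \<in> V - D" for u
    proof -
      have "{e\<in>H-H'. e - D = {u}} = {}" using one_out by blast
      then have 1: "card {e\<in>H-H'. e - D = {u}} = 0" by (simp only: card.empty)
      have "{e\<in>H-H'. u \<in> e \<and> card (e - D) = 2} \<subseteq> {e\<in>?M. u \<in> e}"
      proof
        fix e assume e: "e \<in> {e\<in>H-H'. u \<in> e \<and> card (e - D) = 2}"
        then have "\<not> e \<subseteq> D" using u by blast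
        then show "e \<in> {e\<in>?M. u \<in> e}" using e by (auto simp: H'_def)
      qed
      then have 2: "card {e\<in>H-H'. u \<in> e \<and> card (e - D) = 2} \<le> card {e\<in>?M. u \<in> e}"
        using ltf big_fan_edges_subset[of H D]
        by (intro card_mono) (auto simp: loose_triangle_free_def intro: finite_subset)
      have "{x\<in>D. {x,u} \<in> shadow H'} \<subseteq> {x\<in>D. \<exists>v. v \<notin> D \<and> {x,u,v} \<in> H - ?M}"
      proof
        fix x assume "x \<in> {x\<in>D. {x,u} \<in> shadow H'}"
        then obtain r where x: "x \<in> D" and r: "{x,u,r} \<in> H'"
          using mem_shadow_iff[OF ltf'] by blast
        then have "{x,r,u} \<in> H" "x \<noteq> r"
          using H'sub loose_triangle_free_distinct[OF ltf' r] by (auto simp: insert_commute)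
        then have "r \<notin> D" using no_two[of x r u] x u by blast
        then show "x \<in> {x\<in>D. \<exists>v. v \<notin> D \<and> {x,u,v} \<in> H - ?M}"
          using x r by (auto simp: H'_def)
      qed
      then have 3: "card {x\<in>D. {x,u} \<in> shadow H'} \<le> card {x\<in>D. \<exists>v. v \<notin> D \<and> {x,u,v} \<in> H - ?M}"
        using finD by (intro card_mono) auto
      have "card {e\<in>?M. u \<in> e} + 2 * card {x\<in>D. \<exists>v. v \<notin> D \<and> {x,u,v} \<in> H - ?M} \<le> max (card D) 4"
      proof (rule fan_budget[where Z = "{p,q}"])
        show "card {p,q} \<le> 2" by (simp add: card_insert_if)
        show "v = w" if "s \<in> D" "t \<in> D" "s \<noteq> t" "\<not> (s \<in> {p,q} \<and> t \<in> {p,q})" "v \<notin> D" "w \<notin> D"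
          "{s,u,v} \<in> H" "{t,u,w} \<in> H" for s t v w
          using bipyramid_crossing_edges_share_vertex[OF ltf bip D_def that(1-4) _ that(5-8)] u
          by blast
      qed (use finD u in auto)
      moreover have "max (card D) 4 = 5" using finD(2) by simp
      ultimately show ?thesis using 1 2 3 by linarith
    qed
    then have "(\<Sum>u\<in>V-D. 2 * card {e\<in>H-H'. e - D = {u}} + card {e\<in>H-H'. u \<in> e \<and> card (e - D) = 2}
        + 2 * card {x\<in>D. {x,u} \<in> shadow H'}) \<le> card (V - D) * 5" (is "?s \<le> _")
      using sum_bounded_above[of "V - D" _ "5::nat"] by simp
    moreover have "2 * card H \<le> 2 * card (H \<inter> Pow D) + 2 * card (shadow H' \<inter> Pow D)
      + card (V - D) * (card (V - D) - 1) + ?s"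
    proof (rule card_le_local_charges[OF ltf V(1,2) DV H'sub(1)])
      show "\<not> e \<subseteq> D" if "e \<in> H'" for e using that by (auto simp: H'_def)
      show "e \<inter> D \<noteq> {}" if "e \<in> H - H'" for e
      proof (cases "e \<subseteq> D")
        case True
        moreover have "e \<noteq> {}" using edge(2)[of e] that by auto
        ultimately show ?thesis by blast
      next
        case False
        then have "e \<in> ?M" using that by (auto simp: H'_def)
        then show ?thesis using big_fan_edge_outside(2) ltf by blast
      qed
    qed
    ultimately show ?thesis
      using inside V5 V(3) False
      by (intro card_le_choose_if_charges[where c = 20 and s = ?s and k = 5, OF V5]) auto
  qed
qed

text \<open>
  Besides the edges inside the tetrahedron and the big fans, the pair \<open>{a,b,u}\<close>, \<open>{c,d,u}\<close> is deleted
  whenever both are edges: these two then are the only edges that cover the four pairs between \<open>u\<close>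
  and the tetrahedron. Every outside point is charged at most 4 in the doubled count, and the total
  \<open>12 + 4 * r\<close> is at most \<open>6 * r + 6\<close> since \<open>r \<ge> 3\<close>.
\<close>

lemma card_le_choose_if_two_sided_tetrahedron:
  assumes ltf: "loose_triangle_free H" and V: "finite V" "H \<subseteq> nsets V 3" "7 \<le> card V"
    and tet: "tetrahedron H a b c d" and two: "two_sided H a b c d"
  shows "card H \<le> (card V - 1) choose 2"
proof -
  define K where "K = {a,b,c,d}"
  have dist: "distinct [a,b,c,d]" using tet by (simp add: tetrahedron_def)
  have finK: "finite K" "card K = 4" using dist by (auto simp: K_def)
  have edge: "e \<subseteq> V" "card e = 3" if "e \<in> H" for e
    using V(2) that by (auto simp: nsets_def)
  have finH: "finite H" using ltf by (simp add: loose_triangle_free_def)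
  have KV: "K \<subseteq> V"
    using tet edge(1) unfolding tetrahedron_def K_def by blast
  have V4: "card V = card (V - K) + 4"
    using KV finK V by (simp add: card_Diff_subset)
  have inside: "card (H \<inter> Pow K) \<le> 4"
    using card_triples_in_four[of H, OF edge(2) dist] by (simp add: K_def)
  let ?M = "big_fan_edges H K"
  define W where "W = {e. \<exists>u. u \<notin> K \<and> {a,b,u} \<in> H \<and> {c,d,u} \<in> H \<and> (e = {a,b,u} \<or> e = {c,d,u})}"
  define H' where "H' = H - Pow K - ?M - W"
  have H'sub: "H' \<subseteq> H" "H' \<subseteq> H - Pow K" by (auto simp: H'_def)
  have ltf': "loose_triangle_free H'" using ltf H'sub(1) by (rule loose_triangle_free_subset)
  have two_in: "{s,t} = {a,b} \<or> {s,t} = {c,d}"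
    if "s \<in> K" "t \<in> K" "s \<noteq> t" "{s,t,u} \<in> H" "u \<notin> K" for s t u
    using two that unfolding two_sided_def K_def by (auto simp: insert_commute)
  have kappa: "card (shadow H' \<inter> Pow K) \<le> 2"
  proof -
    have "shadow H' \<inter> Pow K \<subseteq> {{a,b},{c,d}}"
    proof
      fix P assume P: "P \<in> shadow H' \<inter> Pow K"
      then have P': "P \<in> shadow (H - Pow K)" using shadow_mono[OF H'sub(2)] by blast
      obtain s t where st: "P = {s,t}" "s \<noteq> t" "s \<in> K" "t \<in> K"
        using P by (auto simp: shadow_def card_2_iff)
      have "P \<notin> {{a,c},{a,d},{b,c},{b,d}}"
        using P' two_sided_shadow_private[OF ltf two K_def] by blast
      then show "P \<in> {{a,b},{c,d}}"
        using st unfolding K_def by (auto simp: insert_commute)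
    qed
    then have "card (shadow H' \<inter> Pow K) \<le> card {{a,b},{c,d}}"
      by (intro card_mono) auto
    also have "\<dots> \<le> 2" by (simp add: card_insert_if)
    finally show ?thesis .
  qed
  have charge: "2 * card {e\<in>H-H'. e - K = {u}} + card {e\<in>H-H'. u \<in> e \<and> card (e - K) = 2}
      + 2 * card {x\<in>K. {x,u} \<in> shadow H'} \<le> 4" if u: "u \<in> V - K" for u
  proof -
    have uK: "u \<notin> K" using u by blast
    note blocked = tetrahedron_extension_blocks_crossing_edge[OF ltf tet, of u, folded K_def, OF uK]
    have tet': "tetrahedron H c d a b" using tet by (auto simp: tetrahedron_def insert_commute)
    have K': "{c,d,a,b} = K" by (auto simp: K_def)
    note blocked' = tetrahedron_extension_blocks_crossing_edge[OF ltf tet', of u, unfolded K', OF uK]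
    let ?A = "{e\<in>H-H'. e - K = {u}}" and ?B = "{e\<in>H-H'. u \<in> e \<and> card (e - K) = 2}"
    let ?C = "{x\<in>K. {x,u} \<in> shadow H'}"
    have A: "e = {a,b,u} \<or> e = {c,d,u}" "{a,b,u} \<in> H" "{c,d,u} \<in> H" if e: "e \<in> ?A" for e
    proof -
      have "e \<notin> ?M" using e big_fan_edge_outside(1)[OF _ ltf, of e K] by auto
      moreover have "\<not> e \<subseteq> K" using e by blast
      ultimately have "e \<in> W" using e by (auto simp: H'_def)
      then obtain v where v: "v \<notin> K" "{a,b,v} \<in> H" "{c,d,v} \<in> H" "e = {a,b,v} \<or> e = {c,d,v}"
        by (auto simp: W_def)
      then have "e - K = {v}" by (auto simp: K_def)
      then have "v = u" using e by auto
      then show "e = {a,b,u} \<or> e = {c,d,u}" "{a,b,u} \<in> H" "{c,d,u} \<in> H" using v by auto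
    qed
    have B: "?B \<subseteq> {e\<in>?M. u \<in> e}"
    proof
      fix e assume e: "e \<in> ?B"
      then have "\<not> e \<subseteq> K" using u by blast
      moreover have "e \<notin> W"
      proof
        assume "e \<in> W"
        then obtain v where v: "v \<notin> K" "e = {a,b,v} \<or> e = {c,d,v}"
          by (auto simp: W_def)
        then have "e - K = {v}" by (auto simp: K_def)
        then show False using e by simp
      qed
      ultimately show "e \<in> {e\<in>?M. u \<in> e}" using e by (auto simp: H'_def)
    qed
    have finM: "finite {e\<in>?M. u \<in> e}"
      using finH big_fan_edges_subset[of H K] by (auto intro: finite_subset)
    have C: "(\<exists>v. v \<notin> K \<and> {x,u,v} \<in> H - ?M) \<or> (x \<in> {a,b} \<and> {a,b,u} \<in> H' \<or> x \<in> {c,d} \<and> {c,d,u} \<in> H')"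
      if x: "x \<in> ?C" for x
    proof -
      obtain r where xK: "x \<in> K" and r: "{x,u,r} \<in> H'"
        using mem_shadow_iff[OF ltf'] x by blast
      show ?thesis
      proof (cases "r \<in> K")
        case False
        then show ?thesis using r by (auto simp: H'_def)
      next
        case True
        have e: "{x,r,u} \<in> H'" "{x,r,u} \<in> H" "x \<noteq> r"
          using r H'sub loose_triangle_free_distinct[OF ltf' r] by (auto simp: insert_commute)
        then have "{x,r} = {a,b} \<or> {x,r} = {c,d}"
          using two_in[OF xK True] uK by blast
        moreover have "{x,r,u} = {x,r} \<union> {u}" by blast
        ultimately show ?thesis using e(1) by (auto simp: doubleton_eq_iff insert_commute)
      qed
    qed
    have few: "2 * card ?A + card ?B + 2 * card ?C \<le> 4"
      if "finite S" "card S \<le> 2" "?A = {}" "?C \<subseteq> S"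
        "\<And>x v. x \<in> K \<Longrightarrow> v \<notin> K \<Longrightarrow> {x,u,v} \<in> H \<Longrightarrow> x \<in> S" for S
    proof -
      have "{e\<in>?M. u \<in> e} = {}"
        by (rule no_big_fan_edge_at[OF uK that(1,2)]) (rule that(5))
      then have "?B = {}" using B by (simp only: subset_empty)
      moreover have "card ?C \<le> card S" using that(1,4) by (rule card_mono)
      ultimately show ?thesis using that(2,3) by (simp only: card.empty)
    qed
    \<comment> \<open>If \<open>u\<close> extends a pair, no crossing edge joins \<open>u\<close> to the opposite pair.\<close>
    consider (both) "{a,b,u} \<in> H" "{c,d,u} \<in> H" | (ab) "{a,b,u} \<in> H" "{c,d,u} \<notin> H"
      | (cd) "{a,b,u} \<notin> H" "{c,d,u} \<in> H" | (none) "{a,b,u} \<notin> H" "{c,d,u} \<notin> H"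
      by blast
    then show ?thesis
    proof cases
      case both
      then have nocross: "{x,u,v} \<notin> H" if "x \<in> K" "v \<notin> K" for x v
        using blocked[OF both(1) that(2)] blocked'[OF both(2) that(2)] that(1) by (auto simp: K_def)
      have "{a,b,u} \<in> W" "{c,d,u} \<in> W" using both uK by (auto simp: W_def)
      then have "?C = {}"
        using C nocross by (auto simp: H'_def)
      moreover have "{e\<in>?M. u \<in> e} = {}"
        by (rule no_big_fan_edge_at[OF uK, of "{}"]) (use nocross in auto)
      then have "?B = {}" using B by (simp only: subset_empty)
      moreover have "card ?A \<le> card {{a,b,u},{c,d,u}}"
        using A(1) by (intro card_mono) auto
      moreover have "card {{a,b,u},{c,d,u}} \<le> 2" by (simp add: card_insert_if)
      ultimately show ?thesis by (simp only: card.empty)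
    next
      case ab
      have cross: "x \<in> {a,b}" if "x \<in> K" "v \<notin> K" "{x,u,v} \<in> H" for x v
        using blocked[OF ab(1) that(2)] that(1,3) by (auto simp: K_def)
      show ?thesis
      proof (rule few[of "{a,b}"])
        show "?A = {}" using A(3) ab by blast
        show "?C \<subseteq> {a,b}" using C cross ab H'sub(1) by blast
      qed (use cross in \<open>auto simp: card_insert_if\<close>)
    next
      case cd
      have cross: "x \<in> {c,d}" if "x \<in> K" "v \<notin> K" "{x,u,v} \<in> H" for x v
        using blocked'[OF cd(2) that(2)] that(1,3) by (auto simp: K_def)
      show ?thesis
      proof (rule few[of "{c,d}"])
        show "?A = {}" using A(2) cd by blast
        show "?C \<subseteq> {c,d}" using C cross cd H'sub(1) by blast
      qed (use cross in \<open>auto simp: card_insert_if\<close>)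
    next
      case none
      have "?A = {}" using A none by blast
      moreover have "card ?B \<le> card {e\<in>?M. u \<in> e}" using finM B by (rule card_mono)
      moreover have "card ?C \<le> card {x\<in>K. \<exists>v. v \<notin> K \<and> {x,u,v} \<in> H - ?M}"
      proof (intro card_mono subsetI)
        fix x assume x: "x \<in> ?C"
        then have "\<exists>v. v \<notin> K \<and> {x,u,v} \<in> H - ?M"
          using C[OF x] none H'sub(1) by blast
        then show "x \<in> {x\<in>K. \<exists>v. v \<notin> K \<and> {x,u,v} \<in> H - ?M}" using x by blast
      qed (use finK in simp)
      moreover have "card {e\<in>?M. u \<in> e} + 2 * card {x\<in>K. \<exists>v. v \<notin> K \<and> {x,u,v} \<in> H - ?M} \<le> max (card K) 4"
      proof (rule fan_budget[where Z = "{}"])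
        show "v = w" if "s \<in> K" "t \<in> K" "s \<noteq> t" "\<not> (s \<in> {} \<and> t \<in> {})" "v \<notin> K" "w \<notin> K"
          "{s,u,v} \<in> H" "{t,u,w} \<in> H" for s t v w
          by (rule tetrahedron_crossing_edges_share_vertex[OF ltf tet K_def that(1-3) uK that(5-8)])
      qed (use finK uK in auto)
      moreover have "max (card K) 4 = 4" using finK(2) by simp
      ultimately show ?thesis by (simp only: card.empty)
    qed
  qed
  have "(\<Sum>u\<in>V-K. 2 * card {e\<in>H-H'. e - K = {u}} + card {e\<in>H-H'. u \<in> e \<and> card (e - K) = 2}
      + 2 * card {x\<in>K. {x,u} \<in> shadow H'}) \<le> card (V - K) * 4" (is "?s \<le> _")
    using sum_bounded_above[of "V - K" _ "4::nat"] charge by simp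
  moreover have "2 * card H \<le> 2 * card (H \<inter> Pow K) + 2 * card (shadow H' \<inter> Pow K)
    + card (V - K) * (card (V - K) - 1) + ?s"
  proof (rule card_le_local_charges[OF ltf V(1,2) KV H'sub(1)])
    show "\<not> e \<subseteq> K" if "e \<in> H'" for e using that by (auto simp: H'_def)
    show "e \<inter> K \<noteq> {}" if e: "e \<in> H - H'" for e
    proof -
      consider "e \<subseteq> K" | "e \<in> ?M" | "e \<in> W" using e by (auto simp: H'_def)
      then show ?thesis
      proof cases
        case 1
        moreover have "e \<noteq> {}" using edge(2)[of e] e by auto
        ultimately show ?thesis by blast
      next
        case 2
        then show ?thesis using big_fan_edge_outside(2) ltf by blast
      next
        case 3
        then show ?thesis by (auto simp: W_def K_def)
      qed
    qed
  qed
  ultimately show ?thesis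
    using inside kappa V4 V(3)
    by (intro card_le_choose_if_charges[where c = 12 and s = ?s and k = 4, OF V4]) auto
qed

text \<open>
  All edges on the tetrahedron together with \<open>u\<close> are deleted. Then no pair inside the tetrahedron
  remains covered, which saves 4 in comparison with the two-sided case and allows the point \<open>u\<close> a
  charge of 8 instead of 4.
\<close>

lemma card_le_choose_if_cornered_tetrahedron:
  assumes ltf: "loose_triangle_free H" and V: "finite V" "H \<subseteq> nsets V 3" "7 \<le> card V"
    and tet: "tetrahedron H a b c d" and cor: "cornered H a b c d u"
    and nb: "\<nexists>p q a b c. bipyramid H p q a b c"
  shows "card H \<le> (card V - 1) choose 2"
proof -
  define K where "K = {a,b,c,d}"
  define D where "D = {a,b,c,d,u}"
  have DK: "D = insert u K" by (auto simp: D_def K_def)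
  have dist: "distinct [a,b,c,d]" using tet by (simp add: tetrahedron_def)
  have finK: "finite K" "card K = 4" using dist by (auto simp: K_def)
  have edge: "e \<subseteq> V" "card e = 3" if "e \<in> H" for e
    using V(2) that by (auto simp: nsets_def)
  have finH: "finite H" using ltf by (simp add: loose_triangle_free_def)
  have KV: "K \<subseteq> V"
    using tet edge(1) unfolding tetrahedron_def K_def by blast
  have uVK: "u \<in> V - K"
    using cor edge(1) unfolding cornered_def K_def by blast
  have V4: "card V = card (V - K) + 4"
    using KV finK V by (simp add: card_Diff_subset)
  have inside: "card (H \<inter> Pow K) \<le> 4"
    using card_triples_in_four[of H, OF edge(2) dist] by (simp add: K_def)
  let ?M = "big_fan_edges H K"
  define H' where "H' = H - Pow D - ?M"
  have H'sub: "H' \<subseteq> H" "H' \<subseteq> H - Pow D" by (auto simp: H'_def)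
  have ltf': "loose_triangle_free H'" using ltf H'sub(1) by (rule loose_triangle_free_subset)
  note unique = cornered_extension_unique[OF ltf tet cor K_def]
  note corner = cornered_crossing_edge_at_corner[OF ltf tet cor K_def]
  have kappa: "shadow H' \<inter> Pow K = {}"
  proof -
    have False if P: "P \<in> shadow H'" "P \<subseteq> K" for P
    proof -
      obtain s t where st: "P = {s,t}" "s \<in> K" "t \<in> K"
        using P by (auto simp: shadow_def card_2_iff)
      have "{s,t} \<in> shadow (H - Pow D)" using P(1) st(1) shadow_mono[OF H'sub(2)] by blast
      then show False
        using cornered_shadow_private[OF ltf tet cor D_def, of s t] st(2,3) by (simp add: K_def)
    qed
    then show ?thesis by blast
  qed
  let ?charge = "\<lambda>v. 2 * card {e\<in>H-H'. e - K = {v}} + card {e\<in>H-H'. v \<in> e \<and> card (e - K) = 2}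
      + 2 * card {x\<in>K. {x,v} \<in> shadow H'}"
  have B: "{e\<in>H-H'. v \<in> e \<and> card (e - K) = 2} \<subseteq> {e\<in>?M. v \<in> e}" for v
  proof
    fix e assume e: "e \<in> {e\<in>H-H'. v \<in> e \<and> card (e - K) = 2}"
    have "\<not> e \<subseteq> D"
    proof
      assume "e \<subseteq> D"
      then have "card (e - K) \<le> card {u}" unfolding DK by (intro card_mono) auto
      then show False using e by simp
    qed
    then show "e \<in> {e\<in>?M. v \<in> e}" using e by (auto simp: H'_def)
  qed
  have charge: "?charge v \<le> 4" if v: "v \<in> V - K - {u}" for v
  proof -
    have vK: "v \<notin> K" "v \<noteq> u" using v by auto
    have "{e\<in>H-H'. e - K = {v}} = {}"
    proof -
      have False if "e \<in> H" "e - K = {v}" for e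
      proof (rule edge_with_one_vertex_outside[OF ltf that])
        fix s t assume "e = {s,t,v}" "s \<in> K" "t \<in> K" "s \<noteq> t" "v \<notin> K"
        then show False using unique[of s t v] vK that(1) by simp
      qed
      then show ?thesis by blast
    qed
    moreover have "card {e\<in>H-H'. v \<in> e \<and> card (e - K) = 2} \<le> card {e\<in>?M. v \<in> e}"
      using finH big_fan_edges_subset[of H K] by (intro card_mono B) (auto intro: finite_subset)
    moreover have "card {x\<in>K. {x,v} \<in> shadow H'} \<le> card {x\<in>K. \<exists>w. w \<notin> K \<and> {x,v,w} \<in> H - ?M}"
    proof (intro card_mono subsetI)
      fix x assume "x \<in> {x\<in>K. {x,v} \<in> shadow H'}"
      then obtain r where x: "x \<in> K" and r: "{x,v,r} \<in> H'"
        using mem_shadow_iff[OF ltf'] by blast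
      then have "{x,r,v} \<in> H" "x \<noteq> r"
        using H'sub loose_triangle_free_distinct[OF ltf' r] by (auto simp: insert_commute)
      then have "r \<notin> K" using unique[of x r v] x vK by blast
      then show "x \<in> {x\<in>K. \<exists>w. w \<notin> K \<and> {x,v,w} \<in> H - ?M}"
        using x r by (auto simp: H'_def)
    qed (use finK in auto)
    moreover have "card {e\<in>?M. v \<in> e} + 2 * card {x\<in>K. \<exists>w. w \<notin> K \<and> {x,v,w} \<in> H - ?M} \<le> max (card K) 4"
    proof (rule fan_budget[where Z = "{}"])
      show "x = w" if "s \<in> K" "t \<in> K" "s \<noteq> t" "\<not> (s \<in> {} \<and> t \<in> {})" "x \<notin> K" "w \<notin> K"
        "{s,v,x} \<in> H" "{t,v,w} \<in> H" for s t x w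
        by (rule tetrahedron_crossing_edges_share_vertex[OF ltf tet K_def that(1-3) vK(1) that(5-8)])
    qed (use finK vK in auto)
    moreover have "max (card K) 4 = 4" using finK(2) by simp
    ultimately show ?thesis by (simp only: card.empty)
  qed
  have apex: "?charge u \<le> 8"
  proof -
    have uK: "u \<notin> K" using uVK by blast
    have "{e\<in>H-H'. e - K = {u}} \<subseteq> {e\<in>H. e \<subseteq> {a,b,c,d,u} \<and> u \<in> e}"
      unfolding K_def by blast
    then have "card {e\<in>H-H'. e - K = {u}} \<le> card {e\<in>H. e \<subseteq> {a,b,c,d,u} \<and> u \<in> e}"
      using finH by (intro card_mono) auto
    then have "card {e\<in>H-H'. e - K = {u}} \<le> 3"
      using cornered_card_le[OF ltf tet cor nb] by linarith
    moreover have "{e\<in>?M. u \<in> e} = {}"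
      by (rule no_big_fan_edge_at[OF uK, of "{a}"]) (use corner in auto)
    then have "{e\<in>H-H'. u \<in> e \<and> card (e - K) = 2} = {}" using B[of u] by (simp only: subset_empty)
    moreover have "card {x\<in>K. {x,u} \<in> shadow H'} \<le> card {a}"
    proof (intro card_mono subsetI)
      fix x assume "x \<in> {x\<in>K. {x,u} \<in> shadow H'}"
      then obtain r where x: "x \<in> K" and r: "{x,u,r} \<in> H'"
        using mem_shadow_iff[OF ltf'] by blast
      then have "\<not> {x,u,r} \<subseteq> D" "{x,u,r} \<in> H" by (auto simp: H'_def)
      then have "r \<notin> K" using x DK by blast
      then show "x \<in> {a}" using corner[OF x] \<open>{x,u,r} \<in> H\<close> by blast
    qed simp
    moreover have "card {a} = 1" by simp
    ultimately show ?thesis by (simp only: card.empty)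
  qed
  have "sum ?charge (V - K) = ?charge u + sum ?charge (V - K - {u})"
    using uVK V(1) by (intro sum.remove) auto
  also have "\<dots> \<le> 8 + card (V - K - {u}) * 4"
    using sum_bounded_above[of "V - K - {u}" ?charge 4] charge apex by simp
  finally have s: "sum ?charge (V - K) \<le> 8 + card (V - K - {u}) * 4" .
  have r: "card (V - K) = Suc (card (V - K - {u}))"
    using uVK V(1) by (intro card.remove) auto
  have "2 * card H \<le> 2 * card (H \<inter> Pow K) + 2 * card (shadow H' \<inter> Pow K)
    + card (V - K) * (card (V - K) - 1) + sum ?charge (V - K)"
  proof (rule card_le_local_charges[OF ltf V(1,2) KV H'sub(1)])
    show "\<not> e \<subseteq> K" if "e \<in> H'" for e using that by (auto simp: H'_def DK)
    show "e \<inter> K \<noteq> {}" if "e \<in> H - H'" for e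
    proof (cases "e \<subseteq> D")
      case True
      have "\<not> e \<subseteq> {u}" using edge(2)[of e] that card_mono[of "{u}" e] by auto
      then show ?thesis using True DK by blast
    next
      case False
      then have "e \<in> ?M" using that by (auto simp: H'_def)
      then show ?thesis using big_fan_edge_outside(2) ltf by blast
    qed
  qed
  then show ?thesis
    using inside kappa V4 V(3) s r
    by (intro card_le_choose_if_charges[where c = 8 and s = "sum ?charge (V - K)" and k = 4, OF V4]) auto
qed

text \<open>
  The families of all triples through one point show that the bound is attained. On five points all
  ten triples form a system without loose triangles, so a lower bound on the number of points is
  necessary.
\<close>

theorem loose_triangle_free_card_le:
  assumes "finite V" "H \<subseteq> nsets V 3" "7 \<le> card V" and ltf: "loose_triangle_free H"
  shows "card H \<le> (card V - 1) choose 2"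
  using ltf
proof (cases rule: even_family_cluster_cases)
  case even_free
  moreover have "V \<noteq> {}" using assms(3) by auto
  ultimately show ?thesis
    using card_le_choose_if_no_even_family[OF assms(1) _ assms(2)] by blast
next
  case (bip p q a b c)
  then show ?thesis using card_le_choose_if_bipyramid[OF ltf assms(1-3)] by blast
next
  case (two a b c d)
  then show ?thesis using card_le_choose_if_two_sided_tetrahedron[OF ltf assms(1-3)] by blast
next
  case (cor a b c d u)
  then show ?thesis using card_le_choose_if_cornered_tetrahedron[OF ltf assms(1-3)] by blast
qed

section \<open>From links to hypergraphs without VD3\<close>

definition vertex_link :: "'a set set \<Rightarrow> 'a \<Rightarrow> 'a set set" where
  "vertex_link E v = (\<lambda>e. e - {v}) ` {e\<in>E. v \<in> e}"

lemma mem_vertex_linkD: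
  assumes "e \<in> vertex_link E v"
  shows "insert v e \<in> E" "v \<notin> e"
  using assms by (auto simp: vertex_link_def insert_absorb)

lemma card_vertex_link: "card (vertex_link E v) = card {e\<in>E. v \<in> e}"
  unfolding vertex_link_def by (rule card_image) (auto simp: inj_on_def)

lemma VD3_verts:
  "hverts VD3 = {{1},{2},{3},{1,2},{1,3},{2,3},{1,2,3}}"
proof -
  have I: "{1..3::nat} = {1,2,3}" by auto
  show ?thesis
    unfolding VD3_def fst_conv I Pow_insert Pow_empty image_insert image_empty
    by (simp add: insert_Diff_if insert_commute)
qed

text \<open>
  The vertex \<open>v\<close> plays \<open>{1,2,3}\<close>, the core of the loose triangle plays the three two-element sets,
  and the three remaining points play the singletons.
\<close>

lemma contains_VD3_if_loose_triangle_in_link: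
  assumes E: "uniform_hypergraph k (V, E)"
    and link: "{a,b,x} \<in> vertex_link E v" "{b,c,y} \<in> vertex_link E v" "{a,c,z} \<in> vertex_link E v"
    and dist: "distinct [a,b,c,x,y,z]"
  shows "contains_copy (V, E) VD3"
proof -
  have e: "{v,a,b,x} \<in> E" "{v,b,c,y} \<in> E" "{v,a,c,z} \<in> E"
    and v: "v \<notin> {a,b,c,x,y,z}"
    using mem_vertex_linkD[OF link(1)] mem_vertex_linkD[OF link(2)] mem_vertex_linkD[OF link(3)]
    by auto
  have V: "{v,a,b,x} \<subseteq> V" "{v,b,c,y} \<subseteq> V" "{v,a,c,z} \<subseteq> V"
    using E e unfolding uniform_hypergraph_def nsets_def by auto
  \<comment> \<open>Testing membership of 1, 2, 3 avoids comparing the seven vertices as sets.\<close>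
  define f where "f S = (if 1 \<in> S then (if 2 \<in> S then (if 3 \<in> S then v else b) else (if 3 \<in> S then a else x))
    else (if 2 \<in> S then (if 3 \<in> S then c else y) else z))" for S :: "nat set"
  have "inj_on f (hverts VD3)"
    using dist v unfolding VD3_verts by (simp add: f_def) blast
  moreover have "f ` hverts VD3 \<subseteq> V"
    using V unfolding VD3_verts by (simp add: f_def)
  moreover have "f ` e \<in> E" if "e \<in> hedges VD3" for e
    using that e unfolding VD3_edges by (auto simp: f_def insert_commute)
  ultimately show ?thesis
    unfolding contains_copy_def by auto
qed

lemma loose_triangle_free_vertex_link:
  assumes E: "uniform_hypergraph 4 (V, E)" and free: "\<not> contains_copy (V, E) VD3"
  shows "loose_triangle_free (vertex_link E v)" "vertex_link E v \<subseteq> nsets (V - {v}) 3"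
proof -
  have V: "finite V" "E \<subseteq> nsets V 4"
    using E by (auto simp: uniform_hypergraph_def)
  then have "finite E" by (meson finite_imp_finite_nsets finite_subset)
  show sub: "vertex_link E v \<subseteq> nsets (V - {v}) 3"
    using V unfolding vertex_link_def nsets_def by auto
  show "loose_triangle_free (vertex_link E v)"
    unfolding loose_triangle_free_def
  proof (intro conjI ballI)
    show "finite (vertex_link E v)" using \<open>finite E\<close> by (simp add: vertex_link_def)
    show "card e = 3" if "e \<in> vertex_link E v" for e using sub that by (auto simp: nsets_def)
    show "\<nexists>a b c x y z. distinct [a,b,c,x,y,z] \<and> {a,b,x} \<in> vertex_link E v \<and>
      {b,c,y} \<in> vertex_link E v \<and> {a,c,z} \<in> vertex_link E v"
      using contains_VD3_if_loose_triangle_in_link[OF E] free by blast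
  qed
qed

text \<open>
  Summing the sizes of the links counts every edge four times.
\<close>

lemma VD3_free_card_le:
  assumes E: "uniform_hypergraph 4 (V, E)" and free: "\<not> contains_copy (V, E) VD3"
    and "8 \<le> card V"
  shows "4 * card E \<le> card V * ((card V - 2) choose 2)"
proof -
  have V: "finite V" "E \<subseteq> nsets V 4"
    using E by (auto simp: uniform_hypergraph_def)
  then have "finite E" by (meson finite_imp_finite_nsets finite_subset)
  have "4 * card E = (\<Sum>v\<in>V. card {e\<in>E. v \<in> e})"
  proof (rule sum_multicount[symmetric, OF V(1) \<open>finite E\<close>])
    show "\<forall>e\<in>E. card {v\<in>V. v \<in> e} = 4"
    proof
      fix e assume "e \<in> E"
      then have "e \<subseteq> V" "card e = 4" using V(2) by (auto simp: nsets_def)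
      then show "card {v\<in>V. v \<in> e} = 4" by (simp add: Int_absorb1 Collect_conj_eq)
    qed
  qed
  also have "\<dots> \<le> (\<Sum>v\<in>V. (card V - 2) choose 2)"
  proof (rule sum_mono)
    fix v assume v: "v \<in> V"
    have "card (vertex_link E v) \<le> (card (V - {v}) - 1) choose 2"
      using loose_triangle_free_vertex_link[OF E free] V v assms(3)
      by (intro loose_triangle_free_card_le) auto
    then show "card {e\<in>E. v \<in> e} \<le> (card V - 2) choose 2"
      using V(1) v by (simp add: card_vertex_link numeral_2_eq_2)
  qed
  finally show ?thesis by simp
qed

section \<open>A large hypergraph without VD3\<close>

text \<open>
  The points are grouped into consecutive pairs. An edge consists of a pair and two arbitrary larger
  points; the index \<open>i\<close> names the pair.
\<close>

definition paired_block :: "nat \<Rightarrow> nat \<Rightarrow> nat set set" where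
  "paired_block n i = (\<lambda>P. {2 * i - 1, 2 * i} \<union> P) ` nsets {2 * i + 1..n} 2"

lemma mem_paired_block:
  assumes "e \<in> paired_block n i"
  shows "2 * i - 1 \<in> e" "2 * i \<in> e" "s \<in> e \<Longrightarrow> 2 * i - 1 \<le> s"
proof -
  obtain P where e: "e = {2 * i - 1, 2 * i} \<union> P" and P: "P \<subseteq> {2 * i + 1..n}"
    using assms by (auto simp: paired_block_def nsets_def)
  show "2 * i - 1 \<in> e" "2 * i \<in> e" unfolding e by simp_all
  show "2 * i - 1 \<le> s" if "s \<in> e"
  proof (cases "s \<in> P")
    case True
    then have "s \<in> {2 * i + 1..n}" using P by blast
    then show ?thesis unfolding atLeastAtMost_iff by linarith
  next
    case False
    then show ?thesis using that e by auto
  qed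
qed

lemma card_paired_block: "card (paired_block n i) = (n - 2 * i) choose 2"
proof -
  have "inj_on (\<lambda>P. {2 * i - 1, 2 * i} \<union> P) (nsets {2 * i + 1..n} 2)"
  proof (rule inj_on_inverseI)
    fix P assume "P \<in> nsets {2 * i + 1..n} 2"
    then show "({2 * i - 1, 2 * i} \<union> P) \<inter> {2 * i + 1..n} = P"
      by (auto simp: nsets_def)
  qed
  then show ?thesis
    unfolding paired_block_def by (simp add: card_image)
qed

lemma paired_block_subset:
  assumes "1 \<le> i" "2 * i \<le> n"
  shows "paired_block n i \<subseteq> nsets {1..n} 4"
proof
  fix e assume "e \<in> paired_block n i"
  then obtain P where e: "e = {2 * i - 1, 2 * i} \<union> P" and P: "P \<in> nsets {2 * i + 1..n} 2"
    unfolding paired_block_def by blast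
  obtain s t where Pst: "P = {s,t}" and st: "s \<in> {2 * i + 1..n}" "t \<in> {2 * i + 1..n}" "s \<noteq> t"
    using P by (rule nsets2_E)
  have "card {2 * i - 1, 2 * i, s, t} = 4"
    using assms st by (auto simp: card_insert_if)
  then have "card e = 4" by (simp add: e Pst insert_commute)
  moreover have "e \<subseteq> {1..n}" unfolding e Pst using st assms by auto
  ultimately show "e \<in> nsets {1..n} 4" by (auto simp: nsets_def finite_subset)
qed

lemma paired_blocks_disjoint:
  assumes "1 \<le> i" "1 \<le> j" "i \<noteq> j"
  shows "paired_block n i \<inter> paired_block n j = {}"
proof -
  have "e \<notin> paired_block n j" if "1 \<le> i" "i < j" "e \<in> paired_block n i" for e i j
    using mem_paired_block(1)[OF that(3)] mem_paired_block(3)[of e n j "2 * i - 1"] that(1,2) by auto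
  then show ?thesis using assms by (metis disjoint_iff linorder_neqE_nat)
qed

text \<open>
  Consider the edge whose index is least. All of its points except \<open>x\<close> lie in one of the other two
  edges, so its pair meets another edge; as that edge has no points below its own pair, it has the
  same pair. But then the pair is the common part of these two edges, it contains \<open>v\<close>, hence meets
  the third edge as well, which therefore also contains the pair. The three edges would have two
  common points.
\<close>

lemma no_VD3_pattern_from_least_block:
  assumes A: "{x,a,b,v} \<in> paired_block n i" and B: "{y,b,c,v} \<in> paired_block n j"
    and C: "{z,a,c,v} \<in> paired_block n k"
    and dist: "distinct [a,b,c,x,y,z,v]" and i: "1 \<le> i" "i \<le> j" "i \<le> k"
  shows False
proof -
  let ?p = "2 * i - 1" and ?q = "2 * i"
  have pq: "?p \<in> {x,a,b,v}" "?q \<in> {x,a,b,v}" "?p \<noteq> ?q"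
    using mem_paired_block(1,2)[OF A] i by auto
  have j: "j = i" if "s \<in> {?p,?q}" "s \<in> {y,b,c,v}" for s
    using mem_paired_block(3)[OF B that(2)] that(1) i by auto
  have k: "k = i" if "s \<in> {?p,?q}" "s \<in> {z,a,c,v}" for s
    using mem_paired_block(3)[OF C that(2)] that(1) i by auto
  have jB: "{?p,?q} = {b,v}" if "j = i"
    using mem_paired_block(1,2)[OF B] that pq dist by auto
  have kC: "{?p,?q} = {a,v}" if "k = i"
    using mem_paired_block(1,2)[OF C] that pq dist by auto
  have "j = i \<or> k = i"
    using pq j[of ?p] j[of ?q] k[of ?p] k[of ?q] by auto
  then have "j = i" "k = i"
    using jB kC j[of v] k[of v] by auto
  then have "{b,v} = {a,v}" using jB kC by simp
  then show False using dist by (auto simp: doubleton_eq_iff)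
qed

lemma paired_blocks_VD3_free:
  "\<not> contains_copy (V, \<Union>i\<in>{1..m}. paired_block n i) VD3"
proof
  assume "contains_copy (V, \<Union>i\<in>{1..m}. paired_block n i) VD3"
  then obtain f where inj: "inj_on f (hverts VD3)"
    and edges: "\<forall>e\<in>hedges VD3. f ` e \<in> (\<Union>i\<in>{1..m}. paired_block n i)"
    unfolding contains_copy_def by auto
  define x y z a b c v where "x = f {1}" "y = f {2}" "z = f {3}" "a = f {1,3}" "b = f {1,2}"
    "c = f {2,3}" "v = f {1,2,3}"
  note defs = this
  obtain i j k where i: "1 \<le> i" "{x,a,b,v} \<in> paired_block n i"
    and j: "1 \<le> j" "{y,b,c,v} \<in> paired_block n j" and k: "1 \<le> k" "{z,a,c,v} \<in> paired_block n k"
    using edges unfolding VD3_edges defs by (auto simp: insert_commute)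
  have "distinct (map f [{1,3},{1,2},{2,3},{1},{2},{3},{1,2,3}])"
    unfolding distinct_map
  proof
    show "distinct [{1,3},{1,2},{2,3},{1},{2},{3::nat},{1,2,3}]"
      by (auto simp: insert_eq_iff doubleton_eq_iff)
    show "inj_on f (set [{1,3},{1,2},{2,3},{1},{2},{3},{1,2,3}])"
      using inj unfolding VD3_verts by (rule inj_on_subset) auto
  qed
  then have dist: "distinct [a,b,c,x,y,z,v]" by (simp add: defs)
  consider "i \<le> j" "i \<le> k" | "j \<le> i" "j \<le> k" | "k \<le> i" "k \<le> j" by linarith
  then show False
  proof cases
    case 1
    then show False using no_VD3_pattern_from_least_block[OF i(2) j(2) k(2) dist i(1)] by blast
  next
    case 2
    have "{y,c,b,v} \<in> paired_block n j" using j(2) by (simp add: insert_commute)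
    moreover have "{x,b,a,v} \<in> paired_block n i" using i(2) by (simp add: insert_commute)
    moreover have "{z,c,a,v} \<in> paired_block n k" using k(2) by (simp add: insert_commute)
    ultimately show False
      using no_VD3_pattern_from_least_block[of y c b v n j x a i z k] dist j(1) 2 by auto
  next
    case 3
    have "{x,b,a,v} \<in> paired_block n i" using i(2) by (simp add: insert_commute)
    moreover have "{y,b,c,v} \<in> paired_block n j" using j(2) by simp
    moreover have "{z,c,a,v} \<in> paired_block n k" using k(2) by (simp add: insert_commute)
    ultimately show False
      using no_VD3_pattern_from_least_block[of z c a v n k x b i y j] dist k(1) 3
      by (auto simp: insert_commute)
  qed
qed

theorem theorem1p3:
  fixes n :: nat
  assumes "n \<ge> 8"
  shows "(\<Sum>i = 1..n div 2. (n - 2 * i) choose 2) \<le> ex_num 4 n VD3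
    \<and> real (ex_num 4 n VD3) \<le> real n / 4 * real ((n - 2) choose 2)"
proof
  have fin: "finite (free_sizes 4 {1..n} VD3)"
    by (rule free_sizes_finite) simp
  have "hedges VD3 \<noteq> {}" unfolding VD3_edges by blast
  then have ne: "free_sizes 4 {1..n} VD3 \<noteq> {}"
    using free_sizes_nonempty[of "{1..n}" VD3 4] by auto
  define E where "E = (\<Union>i\<in>{1..n div 2}. paired_block n i)"
  have "E \<subseteq> nsets {1..n} 4"
    using paired_block_subset[of _ n] by (fastforce simp: E_def)
  then have unif: "uniform_hypergraph 4 ({1..n}, E)"
    by (simp add: uniform_hypergraph_def)
  have "card E = (\<Sum>i = 1..n div 2. card (paired_block n i))"
    unfolding E_def
  proof (rule card_UN_disjoint)
    show "\<forall>i\<in>{1..n div 2}. finite (paired_block n i)"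
      by (simp add: paired_block_def finite_imp_finite_nsets)
    show "\<forall>i\<in>{1..n div 2}. \<forall>j\<in>{1..n div 2}. i \<noteq> j \<longrightarrow> paired_block n i \<inter> paired_block n j = {}"
      using paired_blocks_disjoint by simp
  qed simp
  then have "card E = (\<Sum>i = 1..n div 2. (n - 2 * i) choose 2)"
    by (simp add: card_paired_block)
  moreover have "\<not> contains_copy ({1..n}, E) VD3"
    unfolding E_def by (rule paired_blocks_VD3_free)
  then have "card E \<in> free_sizes 4 {1..n} VD3"
    using unif unfolding free_sizes_def by force
  ultimately show "(\<Sum>i = 1..n div 2. (n - 2 * i) choose 2) \<le> ex_num 4 n VD3"
    using fin by (simp add: ex_num_def)
  have "ex_num 4 n VD3 \<in> free_sizes 4 {1..n} VD3"
    unfolding ex_num_def using fin ne by (rule Max_in)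
  then obtain H where H: "ex_num 4 n VD3 = card (hedges H)" "hverts H = {1..n}"
    "uniform_hypergraph 4 H" "\<not> contains_copy H VD3"
    unfolding free_sizes_def by blast
  then have "4 * card (hedges H) \<le> n * ((n - 2) choose 2)"
    using VD3_free_card_le[of "{1..n}" "hedges H"] assms by (metis card_atLeastAtMost diff_Suc_1 prod.collapse)
  then have "real (4 * card (hedges H)) \<le> real (n * ((n - 2) choose 2))"
    by (simp only: of_nat_le_iff)
  then show "real (ex_num 4 n VD3) \<le> real n / 4 * real ((n - 2) choose 2)"
    using H(1) by simp
qed

end
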